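(* Let $\Delta\in\mathbb{N}$ and let $\lambda\in\mathbb{C}$ be such that $|\lambda|<\lambda^*(\Delta):=\frac{(\Delta-1)^{\Delta-1}}{\Delta^{\Delta}}$. Then there exists a deterministic algorithm which, given a graph $G=(V,E)$ of maximum degree at most $\Delta$ and $\varepsilon>0$, computes a multiplicative $\varepsilon$-approximation to $Z(G)(\lambda)$ in time $(|V|/\varepsilon)^{O(1)}$.
   Context: For a graph $G=(V,E)$, the independence polynomial is $Z(G)(\lambda):=\sum_{I\subseteq V,\ I\text{ independent}}\lambda^{|I|}$. For non-zero complex numbers $q,\xi$, $\xi$ is called a multiplicative $\varepsilon$-approximation to $q$ if $e^{-\varepsilon}\le |q|/|\xi|\le e^{\varepsilon}$ and the angle between $\xi$ and $q$ (as vectors in $\mathbb{C}=\mathbb{R}^2$) is at most $\varepsilon$. The running time is an asymptotic bound; the constant implicit in the exponent $O(1)$ may depend on the fixed data $\Delta$ and $\lambda$, but not on $G$ or $\varepsilon$.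
   Formalization: The case Δ=1, λ=-1/2 is excluded (there Z(K_2)(λ)=0, so the claim fails); the time bound is max(2, |V|/min(1,ε))^{O(1)}, as the literal bound fails for large ε or |V|/ε≤1; time counts unit-cost steps with exact complex arithmetic. *)

theory Defs
  imports Complex_Main "HOL-Analysis.Inner_Product"
begin

section \<open>Graphs and the independence polynomial\<close>

definition simple_graph :: "'a set \<Rightarrow> 'a set set \<Rightarrow> bool" where
  "simple_graph V E \<longleftrightarrow> finite V \<and> (\<forall>e\<in>E. e \<subseteq> V \<and> card e = 2)"

definition graph_degree :: "'a set set \<Rightarrow> 'a \<Rightarrow> nat" where
  "graph_degree E v = card {e \<in> E. v \<in> e}"

definition indep_set :: "'a set set \<Rightarrow> 'a set \<Rightarrow> bool" where
  "indep_set E I \<longleftrightarrow> (\<forall>e\<in>E. \<not> e \<subseteq> I)"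

definition indep_poly :: "'a set \<Rightarrow> 'a set set \<Rightarrow> complex \<Rightarrow> complex" where
  "indep_poly V E z = (\<Sum>I | I \<subseteq> V \<and> indep_set E I. z ^ card I)"

text \<open>Integer exponents keep the formula literal at \<open>\<Delta> = 0\<close>, where it gives \<open>-1\<close>. At
  \<open>\<Delta> = 1\<close> it gives \<open>0 ^ 0 / 1 = 1\<close>; note that the single edge has
  \<open>Z(G)(\<lambda>) = 1 + 2 \<lambda>\<close>, which vanishes at \<open>\<lambda> = - 1 / 2\<close>, inside the open unit disc.\<close>

definition lambda_star :: "nat \<Rightarrow> real" where
  "lambda_star \<Delta> = (real \<Delta> - 1) powi (int \<Delta> - 1) / real \<Delta> ^ \<Delta>"


section \<open>Multiplicative approximation\<close>

definition vec_angle :: "complex \<Rightarrow> complex \<Rightarrow> real" where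
  "vec_angle x y = arccos (inner x y / (norm x * norm y))"

definition mult_approx :: "real \<Rightarrow> complex \<Rightarrow> complex \<Rightarrow> bool" where
  "mult_approx \<epsilon> \<xi> q \<longleftrightarrow> q \<noteq> 0 \<and> \<xi> \<noteq> 0 \<and>
     exp (- \<epsilon>) \<le> norm q / norm \<xi> \<and> norm q / norm \<xi> \<le> exp \<epsilon> \<and> vec_angle \<xi> q \<le> \<epsilon>"


section \<open>Deterministic random access machine with exact complex arithmetic\<close>

text \<open>
  An arbitrary \<open>\<lambda> \<in> \<complex>\<close> has no finite description, so the algorithm works in the unit-cost
  (Blum--Shub--Smale / real RAM) model with exact arithmetic. There are two memories,
  addressed by natural numbers: one holding natural numbers (used for control and for indirect
  addressing) and one holding complex numbers. A program is a finite syntactic object; its only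
  primitives are addition, truncated subtraction and comparison of naturals, conversion of a
  natural to a complex number, the field operations on complex numbers, and comparison of real
  parts. The only literals are integers. Division by zero yields \<open>0\<close>.
\<close>

datatype nexp = NLit nat | NMem nexp | NAdd nexp nexp | NSub nexp nexp

datatype cexp = CLit int | CMem nexp | COfNat nexp
  | CAdd cexp cexp | CSub cexp cexp | CMul cexp cexp | CDiv cexp cexp

datatype bexp = NLess nexp nexp | ReLess cexp cexp | BNot bexp | BAnd bexp bexp

datatype com = Skip
  | NAssign nexp nexp
  | CAssign nexp cexp
  | Seq com com
  | Ite bexp com com
  | While bexp com

type_synonym state = "(nat \<Rightarrow> nat) \<times> (nat \<Rightarrow> complex)"

primrec nval :: "nexp \<Rightarrow> state \<Rightarrow> nat" where
  "nval (NLit k) s = k"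
| "nval (NMem a) s = fst s (nval a s)"
| "nval (NAdd a b) s = nval a s + nval b s"
| "nval (NSub a b) s = nval a s - nval b s"

primrec cval :: "cexp \<Rightarrow> state \<Rightarrow> complex" where
  "cval (CLit k) s = of_int k"
| "cval (CMem a) s = snd s (nval a s)"
| "cval (COfNat a) s = of_nat (nval a s)"
| "cval (CAdd x y) s = cval x s + cval y s"
| "cval (CSub x y) s = cval x s - cval y s"
| "cval (CMul x y) s = cval x s * cval y s"
| "cval (CDiv x y) s = cval x s / cval y s"

primrec bval :: "bexp \<Rightarrow> state \<Rightarrow> bool" where
  "bval (NLess a b) s = (nval a s < nval b s)"
| "bval (ReLess x y) s = (Re (cval x s) < Re (cval y s))"
| "bval (BNot b) s = (\<not> bval b s)"
| "bval (BAnd b c) s = (bval b s \<and> bval c s)"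

text \<open>Every node of an expression is charged one time unit.\<close>

primrec ncost :: "nexp \<Rightarrow> nat" where
  "ncost (NLit k) = 1"
| "ncost (NMem a) = 1 + ncost a"
| "ncost (NAdd a b) = 1 + ncost a + ncost b"
| "ncost (NSub a b) = 1 + ncost a + ncost b"

primrec ccost :: "cexp \<Rightarrow> nat" where
  "ccost (CLit k) = 1"
| "ccost (CMem a) = 1 + ncost a"
| "ccost (COfNat a) = 1 + ncost a"
| "ccost (CAdd x y) = 1 + ccost x + ccost y"
| "ccost (CSub x y) = 1 + ccost x + ccost y"
| "ccost (CMul x y) = 1 + ccost x + ccost y"
| "ccost (CDiv x y) = 1 + ccost x + ccost y"

primrec bcost :: "bexp \<Rightarrow> nat" where
  "bcost (NLess a b) = 1 + ncost a + ncost b"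
| "bcost (ReLess x y) = 1 + ccost x + ccost y"
| "bcost (BNot b) = 1 + bcost b"
| "bcost (BAnd b c) = 1 + bcost b + bcost c"

text \<open>\<open>exec p s t s'\<close>: started in state \<open>s\<close>, program \<open>p\<close> halts in state \<open>s'\<close> after exactly
  \<open>t\<close> time units.\<close>

inductive exec :: "com \<Rightarrow> state \<Rightarrow> nat \<Rightarrow> state \<Rightarrow> bool" where
  Skip: "exec Skip s 1 s"
| NAssign: "exec (NAssign a e) s (1 + ncost a + ncost e)
     ((fst s)(nval a s := nval e s), snd s)"
| CAssign: "exec (CAssign a e) s (1 + ncost a + ccost e)
     (fst s, (snd s)(nval a s := cval e s))"
| Seq: "exec p s t s' \<Longrightarrow> exec q s' u s'' \<Longrightarrow> exec (Seq p q) s (t + u) s''"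
| IteTrue: "bval b s \<Longrightarrow> exec p s t s' \<Longrightarrow> exec (Ite b p q) s (1 + bcost b + t) s'"
| IteFalse: "\<not> bval b s \<Longrightarrow> exec q s t s' \<Longrightarrow> exec (Ite b p q) s (1 + bcost b + t) s'"
| WhileFalse: "\<not> bval b s \<Longrightarrow> exec (While b p) s (1 + bcost b) s"
| WhileTrue: "bval b s \<Longrightarrow> exec p s t s' \<Longrightarrow> exec (While b p) s' u s'' \<Longrightarrow>
     exec (While b p) s (1 + bcost b + t + u) s''"

inductive_cases exec_SkipE: "exec Skip s t s'"
  and exec_NAssignE: "exec (NAssign a e) s t s'"
  and exec_CAssignE: "exec (CAssign a e) s t s'"
  and exec_SeqE: "exec (Seq p q) s t s'"
  and exec_IteE: "exec (Ite b p q) s t s'"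
  and exec_WhileE: "exec (While b p) s t s'"

lemma exec_deterministic:
  "exec p s t s' \<Longrightarrow> exec p s u s'' \<Longrightarrow> u = t \<and> s'' = s'"
proof (induction arbitrary: u s'' rule: exec.induct)
  case (Skip s)
  then show ?case by (rule exec_SkipE) simp
next
  case (NAssign a e s)
  then show ?case by (rule exec_NAssignE) simp
next
  case (CAssign a e s)
  then show ?case by (rule exec_CAssignE) simp
next
  case (Seq p s t s1 q v s2)
  from Seq.prems show ?case
    by (rule exec_SeqE) (metis Seq.IH)
next
  case (IteTrue b s p t s1 q)
  from IteTrue.prems show ?case
    by (rule exec_IteE) (use IteTrue.hyps(1) in \<open>auto dest: IteTrue.IH\<close>)
next
  case (IteFalse b s q t s1 p)
  from IteFalse.prems show ?case
    by (rule exec_IteE) (use IteFalse.hyps(1) in \<open>auto dest: IteFalse.IH\<close>)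
next
  case (WhileFalse b s p)
  from WhileFalse.prems show ?case
    by (rule exec_WhileE) (simp_all add: WhileFalse.hyps)
next
  case (WhileTrue b s p t s1 v s2)
  from WhileTrue.prems WhileTrue.hyps(1) obtain t' s1' v' where
    u: "u = 1 + bcost b + t' + v'" and
    body: "exec p s t' s1'" and rest: "exec (While b p) s1' v' s''"
    by - (erule exec_WhileE, simp, simp)
  from WhileTrue.IH(1)[OF body] have "t' = t" "s1' = s1"
    by simp_all
  from rest have "exec (While b p) s1 v' s''"
    unfolding \<open>s1' = s1\<close> .
  from WhileTrue.IH(2)[OF this] u \<open>t' = t\<close> show ?case
    by simp
qed

text \<open>
  The list \<open>vs\<close> numbers the vertices \<open>0, \<dots>, n - 1\<close>. Natural memory: cell \<open>0\<close> holds \<open>n\<close> and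
  cell \<open>1 + i n + j\<close> holds the \<open>(i, j)\<close> entry of the adjacency matrix, for \<open>i, j < n\<close>.
  Complex memory: cell \<open>0\<close> holds the number \<open>\<lambda>\<close>, cell \<open>1\<close> holds \<open>\<epsilon>\<close>. All other
  cells are \<open>0\<close>. The result of a program is read from complex cell \<open>0\<close>.
\<close>

definition initial_state :: "complex \<Rightarrow> 'a set set \<Rightarrow> 'a list \<Rightarrow> real \<Rightarrow> state" where
  "initial_state lam E vs \<epsilon> =
     (let n = length vs in
       ((\<lambda>a. if a = 0 then n
             else if a \<le> n * n
               then of_bool ({vs ! ((a - 1) div n), vs ! ((a - 1) mod n)} \<in> E)
             else 0),
        (\<lambda>a. if a = 0 then lam else if a = 1 then of_real \<epsilon> else 0)))"

definition result :: "state \<Rightarrow> complex" where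
  "result s = snd s 0"

end

theory Submission
  imports Defs
begin

text \<open>
  Deleting the vertices one at a time writes \<open>Z(G)\<close> as a product of ratios \<open>Z(S) / Z(S - u)\<close>, and the
  deletion recurrence expresses such a ratio as \<open>1 + \<lambda> / \<Prod> r\<close>, where \<open>r\<close> runs over the
  ratios of the neighbours of \<open>u\<close>, again taken in successively smaller graphs. Below the root every vertex
  has already lost a neighbour, so at most \<open>\<Delta> - 1\<close> factors occur; for \<open>|\<lambda>| = c \<lambda>*(\<Delta>)\<close> with
  \<open>c < 1\<close> induction gives \<open>|r - 1| \<le> c / \<Delta>\<close>, and on this disc the recursion contracts the maximal
  error by the factor \<open>c\<close>. Truncating at depth \<open>O(log (n / \<epsilon>))\<close> therefore suffices, and the recursion
  tree has polynomial size. This replaces the Taylor expansion of \<open>log Z\<close> by an argument in the style of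
  Weitz and Shearer.
\<close>

section \<open>Ratios of independence polynomials\<close>

text \<open>The threshold is the maximum of x (1 - x)^(\<Delta> - 1), attained at x = 1 / \<Delta>.
  If \<Delta> - 1 factors lie within x of 1, the recursion returns a value within |\<lambda>| / (1 -
  x)^(\<Delta> - 1) of 1, and this is at most x exactly when |\<lambda>| \<le> x (1 - x)^(\<Delta> -
  1). At x = 1 / \<Delta> the Lipschitz bound of the recursion is |\<lambda>| divided by the
  threshold, so invariance and contraction come from the same inequality. Only a root can meet
  \<Delta> factors. Its step need not contract, but it happens once and costs a constant factor. For
  \<Delta> = 1 the disc has radius 1 and does not keep ratios away from 0; there the recursion is
  exact after two levels instead. The machine has integer literals only, neither logarithms nor
  products of naturals. The rate c is therefore traded for halving the error every m levels, the
  depth is found by doubling \<epsilon>, and matrix rows are addressed by pointers that advance by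
  n.\<close>

locale indep_graph =
  fixes N :: "'a \<Rightarrow> 'a set" and lam :: complex
  assumes nbr_sym: "v \<in> N u \<Longrightarrow> u \<in> N v"
    and nbr_irrefl: "u \<notin> N u"
begin

definition indeps :: "'a set \<Rightarrow> 'a set set" where
  "indeps S = {I. I \<subseteq> S \<and> (\<forall>i\<in>I. N i \<inter> I = {})}"

definition Z :: "'a set \<Rightarrow> complex" where
  "Z S = (\<Sum>I\<in>indeps S. lam ^ card I)"

definition ratio :: "'a set \<Rightarrow> 'a \<Rightarrow> complex" where
  "ratio S u = Z S / Z (S - {u})"

lemma finite_indeps: "finite S \<Longrightarrow> finite (indeps S)"
  by (rule finite_subset[of _ "Pow S"]) (auto simp: indeps_def)

lemma Z_empty [simp]: "Z {} = 1"
proof -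
  have "indeps {} = {{}}" by (auto simp: indeps_def)
  then show ?thesis by (simp add: Z_def)
qed

text \<open>An independent set either avoids \<open>u\<close>, or is \<open>u\<close> together with
  an independent set that avoids \<open>u\<close> and its neighbours.\<close>

lemma Z_rec:
  assumes "finite S" "u \<in> S"
  shows "Z S = Z (S - {u}) + lam * Z (S - {u} - N u)"
proof -
  let ?T = "S - {u} - N u"
  have un: "indeps S = indeps (S - {u}) \<union> insert u ` indeps ?T"
  proof (intro equalityI subsetI)
    fix I assume I: "I \<in> indeps S"
    show "I \<in> indeps (S - {u}) \<union> insert u ` indeps ?T"
    proof (cases "u \<in> I")
      case True
      have "I - {u} \<in> indeps ?T"
        using I True by (auto simp: indeps_def)
      moreover have "I = insert u (I - {u})" using True by auto
      ultimately show ?thesis by blast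
    next
      case False
      with I show ?thesis by (auto simp: indeps_def)
    qed
  next
    fix I assume "I \<in> indeps (S - {u}) \<union> insert u ` indeps ?T"
    then show "I \<in> indeps S"
    proof
      assume "I \<in> indeps (S - {u})"
      then show ?thesis by (auto simp: indeps_def)
    next
      assume "I \<in> insert u ` indeps ?T"
      then obtain J where J: "J \<in> indeps ?T" "I = insert u J" by blast
      \<comment> \<open>\<open>indeps\<close> tests the neighbourhood of every member, so adding
        \<open>u\<close> also needs the converse adjacency.\<close>
      have "u \<notin> N j" if "j \<in> J" for j
        using J that nbr_sym[of u j] by (auto simp: indeps_def)
      then show ?thesis
        using J assms nbr_irrefl by (auto simp: indeps_def)
    qed
  qed
  have fin: "finite (indeps (S - {u}))" "finite (indeps ?T)"
    using assms by (auto intro!: finite_indeps)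
  have disj: "indeps (S - {u}) \<inter> insert u ` indeps ?T = {}"
    by (auto simp: indeps_def)
  have inj: "inj_on (insert u) (indeps ?T)"
    by (rule inj_onI) (auto simp: indeps_def)
  have crd: "card (insert u I) = Suc (card I)" if "I \<in> indeps ?T" for I
  proof -
    have "I \<subseteq> S" "u \<notin> I" using that by (auto simp: indeps_def)
    then show ?thesis using assms by (simp add: finite_subset)
  qed
  have "Z S = Z (S - {u}) + (\<Sum>I\<in>insert u ` indeps ?T. lam ^ card I)"
    unfolding Z_def un using fin disj by (subst sum.union_disjoint) auto
  also have "(\<Sum>I\<in>insert u ` indeps ?T. lam ^ card I) = (\<Sum>I\<in>indeps ?T. lam * lam ^ card I)"
    using inj by (simp add: sum.reindex crd)
  finally show ?thesis by (simp add: Z_def sum_distrib_left)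
qed

lemma ratio_eq:
  assumes "finite S" "u \<in> S" "Z (S - {u}) \<noteq> 0"
  shows "ratio S u = 1 + lam * (Z (S - {u} - N u) / Z (S - {u}))"
  using assms by (simp add: ratio_def Z_rec[of S u] divide_simps)

end

section \<open>Zero-freeness and the invariant disc for \<Delta> = D + 1 \<ge> 2\<close>

locale indep_graph_bounded = indep_graph +
  fixes D :: nat and M c :: real
  assumes D_pos: "0 < D"
    and finite_nbr: "finite (N u)"
    and degree: "card (N u) \<le> Suc D"
    and M_def: "M = real (Suc D) / real D"
    and c_def: "c = norm lam * real (Suc D) * M ^ D"
    and c_less: "c < 1"
begin

lemma M_ge: "1 \<le> M" and M_pos: "0 < M"
  using D_pos by (auto simp: M_def divide_simps)

lemma inv_M: "1 / M = 1 - 1 / real (Suc D)"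
  using D_pos by (simp add: M_def field_simps)

lemma c_nonneg: "0 \<le> c"
  using M_pos by (simp add: c_def)

text \<open>Here \<open>M\<close> is 1 / (1 - 1 / \<Delta>) and \<open>c\<close> is |\<lambda>|
  divided by \<open>lambda_star\<close> at \<Delta> = D + 1. The identity is the invariance of the
  disc: \<open>D\<close> inverse factors of modulus at most \<open>M\<close> lead back to radius c /
  \<Delta>. The next one is its analogue for a root with D + 1 factors.\<close>

lemma lam_M: "norm lam * M ^ D = c / real (Suc D)"
  by (simp add: c_def)

lemma lam_M_Suc: "norm lam * M ^ Suc D = c / real D"
  using D_pos by (simp add: c_def M_def)

text \<open>An error e in each of \<open>D\<close> factors changes the product of their inverses by
  at most D M^(D+1) e, so this identity makes \<open>c\<close> the contraction rate.\<close>

lemma lam_contract: "norm lam * (real D * M ^ Suc D) = c"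
  using lam_M_Suc D_pos by (simp add: field_simps)

definition low :: "'a set \<Rightarrow> 'a \<Rightarrow> bool" where
  "low S u \<longleftrightarrow> card (N u \<inter> S) \<le> D"

lemma low_mono: "low S u \<Longrightarrow> T \<subseteq> S \<Longrightarrow> low T u"
  unfolding low_def using finite_nbr[of u]
  by (meson Int_mono card_mono finite_Int order_refl order_trans)

text \<open>The deleted vertex \<open>u\<close> is one of the at most D + 1 neighbours of
  \<open>w\<close>.\<close>

lemma low_nbr:
  assumes "w \<in> N u" "u \<notin> S"
  shows "low S w"
proof -
  have "u \<in> N w" using assms nbr_sym by blast
  then have "card (N w \<inter> S) < card (N w)"
    using assms by (intro psubset_card_mono[OF finite_nbr]) auto
  then show ?thesis using degree[of w] by (simp add: low_def)
qed

lemma norm_ge_inv_M: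
  assumes "norm (x - 1) \<le> c / real (Suc D)"
  shows "1 / M \<le> norm (x::complex)"
proof -
  have "c / real (Suc D) \<le> 1 / real (Suc D)"
    using c_less by (simp add: divide_simps)
  moreover have "1 \<le> norm x + norm (x - 1)"
    using norm_triangle_ineq4[of x "x - 1"] by simp
  ultimately show ?thesis using assms inv_M by linarith
qed

lemma norm_inverse_le_M:
  assumes "norm (x - 1) \<le> c / real (Suc D)"
  shows "x \<noteq> 0" "norm (1 / x :: complex) \<le> M"
proof -
  have pos: "0 < 1 / M" using M_pos by simp
  with norm_ge_inv_M[OF assms] show "x \<noteq> 0" by auto
  have "inverse (norm x) \<le> inverse (1 / M)"
    by (rule le_imp_inverse_le[OF norm_ge_inv_M[OF assms] pos])
  then show "norm (1 / x) \<le> M" by (simp add: norm_divide inverse_eq_divide)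
qed

text \<open>Deleting \<open>B\<close> vertex by vertex turns the quotient into a product of inverse
  ratios, each at most \<open>M\<close>. Non-vanishing and the ratio bound are hypotheses about
  subsets of \<open>S\<close> because the lemma is applied inside the induction that establishes
  them.\<close>

lemma quotient_bound:
  assumes "finite B" "B \<subseteq> S" "\<And>u. u \<in> B \<Longrightarrow> low S u"
    and nz: "\<And>T. T \<subseteq> S \<Longrightarrow> Z T \<noteq> 0"
    and ratio: "\<And>T u. T \<subseteq> S \<Longrightarrow> u \<in> T \<Longrightarrow> low T u \<Longrightarrow> norm (ratio T u - 1) \<le> c / real (Suc D)"
  shows "norm (Z (S - B) / Z S) \<le> M ^ card B"
  using assms(1,2,3)
proof (induction B rule: finite_induct)
  case empty
  then show ?case using nz[of S] by simp
next
  case (insert u B)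
  let ?T = "S - B"
  have lo: "low ?T u" by (rule low_mono[OF insert.prems(2)]) auto
  have "norm (ratio ?T u - 1) \<le> c / real (Suc D)"
    by (rule ratio[OF _ _ lo]) (use insert.prems(1) insert.hyps(2) in auto)
  note * = norm_inverse_le_M(2)[OF this]
  have IH: "norm (Z ?T / Z S) \<le> M ^ card B"
    by (rule insert.IH) (use insert.prems in auto)
  have eq: "S - insert u B = ?T - {u}" by auto
  have "Z ?T \<noteq> 0" by (rule nz) auto
  then have "Z (S - insert u B) / Z S = 1 / ratio ?T u * (Z ?T / Z S)"
    unfolding eq ratio_def by simp
  then have "norm (Z (S - insert u B) / Z S) = norm (1 / ratio ?T u) * norm (Z ?T / Z S)"
    by (simp only: norm_mult)
  also have "\<dots> \<le> M * M ^ card B"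
    by (rule mult_mono[OF * IH]) (use M_pos in auto)
  finally show ?case using insert.hyps by simp
qed

text \<open>Both claims have to be proved together: the ratio at \<open>u\<close> is expressed by
  quotients over smaller sets, which must not vanish, and conversely \<open>Z S\<close> is non-zero
  because some ratio lies within distance less than 1 of 1.\<close>

lemma nonzero_and_ratio:
  "finite S \<Longrightarrow> Z S \<noteq> 0 \<and> (\<forall>u\<in>S. norm (ratio S u - 1) \<le> c / real D \<and>
     (low S u \<longrightarrow> norm (ratio S u - 1) \<le> c / real (Suc D)))"
proof (induction "card S" arbitrary: S rule: less_induct)
  case less
  have IH: "Z T \<noteq> 0" "u \<in> T \<Longrightarrow> low T u \<Longrightarrow> norm (ratio T u - 1) \<le> c / real (Suc D)"
    if "T \<subset> S" for T u
    using less.hyps[of T] less.prems that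
    by (auto simp: psubset_card_mono finite_subset[of T S])
  have main: "norm (ratio S u - 1) \<le> c / real D \<and>
     (low S u \<longrightarrow> norm (ratio S u - 1) \<le> c / real (Suc D))" if u: "u \<in> S" for u
  proof -
    let ?T = "S - {u}"
    let ?B = "N u \<inter> ?T"
    have sub: "?T \<subset> S" using u by auto
    have eq: "?T - ?B = ?T - N u" by auto
    have "norm (Z (?T - ?B) / Z ?T) \<le> M ^ card ?B"
    proof (rule quotient_bound)
      show "low ?T w" if "w \<in> ?B" for w using that by (intro low_nbr[of w u]) auto
      show "Z T' \<noteq> 0" if "T' \<subseteq> ?T" for T'
        using that sub by (intro IH(1)) auto
      show "norm (ratio T' w - 1) \<le> c / real (Suc D)"
        if "T' \<subseteq> ?T" "w \<in> T'" "low T' w" for T' w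
        using that sub by (intro IH(2)) auto
    qed (use less.prems in auto)
    then have "norm lam * norm (Z (?T - ?B) / Z ?T) \<le> norm lam * M ^ card ?B"
      by (intro mult_left_mono) auto
    moreover have "ratio S u - 1 = lam * (Z (?T - ?B) / Z ?T)"
      unfolding eq using ratio_eq[OF less.prems u] IH(1)[OF sub] by simp
    ultimately have 1: "norm (ratio S u - 1) \<le> norm lam * M ^ card ?B"
      by (metis norm_mult)
    have "card ?B \<le> Suc D"
      using degree[of u] card_mono[OF finite_nbr, of ?B u] by auto
    then have "norm lam * M ^ card ?B \<le> norm lam * M ^ Suc D"
      by (intro mult_left_mono power_increasing M_ge) auto
    moreover have "norm lam * M ^ card ?B \<le> norm lam * M ^ D" if "low S u"
    proof -
      have "N u \<inter> S = ?B" using nbr_irrefl by auto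
      then show ?thesis using that M_ge
        by (intro mult_left_mono power_increasing) (auto simp: low_def)
    qed
    ultimately show ?thesis using 1 lam_M lam_M_Suc by fastforce
  qed
  have "Z S \<noteq> 0"
  proof (cases "S = {}")
    case False
    then obtain u where u: "u \<in> S" by auto
    \<comment> \<open>The chosen \<open>u\<close> may have all its D + 1 neighbours in
      \<open>S\<close>, so only the weaker radius c / D is available; it suffices.\<close>
    have "c / real D < 1" using c_less c_nonneg D_pos by (auto simp: divide_simps)
    then have "norm (ratio S u - 1) < 1" using main[OF u] by linarith
    then have "ratio S u \<noteq> 0" by auto
    then show ?thesis by (auto simp: ratio_def)
  qed auto
  then show ?case using main by blast
qed

lemmas Z_nonzero = nonzero_and_ratio[THEN conjunct1]

lemma ratio_bound: "finite S \<Longrightarrow> u \<in> S \<Longrightarrow> norm (ratio S u - 1) \<le> c / real D"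
  and ratio_bound_low:
    "finite S \<Longrightarrow> u \<in> S \<Longrightarrow> low S u \<Longrightarrow> norm (ratio S u - 1) \<le> c / real (Suc D)"
  using nonzero_and_ratio by blast+

end

section \<open>The recursion truncated at a given depth\<close>

context indep_graph begin

text \<open>The list \<open>us\<close> is the part of the vertex list \<open>vs\<close> still to be
  scanned for members of \<open>B\<close>. Each member found is deleted before the scan goes on, so
  the exact product telescopes to Z S / Z (S - B) over the scanned vertices. Exhausted depth
  replaces the product by 1, the value at the centre of the disc.\<close>

fun trunc_prod :: "'a list \<Rightarrow> nat \<Rightarrow> 'a set \<Rightarrow> 'a set \<Rightarrow> 'a list \<Rightarrow> complex" where
  "trunc_prod vs 0 B S us = 1"
| "trunc_prod vs (Suc b) B S [] = 1"
| "trunc_prod vs (Suc b) B S (u # us) =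
     (if u \<in> B \<inter> S
      then (1 + lam / trunc_prod vs b (N u) (S - {u}) vs) * trunc_prod vs (Suc b) B (S - {u}) us
      else trunc_prod vs (Suc b) B S us)"

definition trunc_ratio :: "'a list \<Rightarrow> nat \<Rightarrow> 'a set \<Rightarrow> 'a \<Rightarrow> complex" where
  "trunc_ratio vs b S u = 1 + lam / trunc_prod vs b (N u) (S - {u}) vs"

lemma trunc_prod_Cons:
  "trunc_prod vs (Suc b) B S (u # us) =
     (if u \<in> B \<inter> S then trunc_ratio vs b S u * trunc_prod vs (Suc b) B (S - {u}) us
      else trunc_prod vs (Suc b) B S us)"
  by (simp add: trunc_ratio_def)

end

context indep_graph_bounded begin

text \<open>The estimates concern the inverse product, as this is what the recursion multiplies by
  \<lambda>. An inverse factor has modulus at most \<open>M\<close> and error at most M^2 e, so d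
  factors together have error at most d M^(d+1) e. The size bound has to be carried along for
  this.\<close>

lemma trunc_prod_approx:
  assumes child: "\<And>T u. T \<subseteq> set vs \<Longrightarrow> u \<in> T \<Longrightarrow> low T u \<Longrightarrow>
      norm (trunc_ratio vs b T u - 1) \<le> c / real (Suc D) \<and>
      norm (trunc_ratio vs b T u - ratio T u) \<le> e"
    and e: "0 \<le> e"
  shows "distinct us \<Longrightarrow> S \<subseteq> set vs \<Longrightarrow> (\<And>u. u \<in> B \<Longrightarrow> low S u) \<Longrightarrow>
     norm (1 / trunc_prod vs (Suc b) B S us) \<le> M ^ card (B \<inter> S \<inter> set us) \<and>
     norm (1 / trunc_prod vs (Suc b) B S us - Z (S - (B \<inter> set us)) / Z S)
       \<le> real (card (B \<inter> S \<inter> set us)) * M ^ Suc (card (B \<inter> S \<inter> set us)) * e"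
proof (induction us arbitrary: S)
  case Nil
  have "Z S \<noteq> 0" using Nil by (intro Z_nonzero) (auto intro: finite_subset)
  then show ?case by simp
next
  case (Cons u us)
  show ?case
  proof (cases "u \<in> B \<inter> S")
    case False
    then have 1: "B \<inter> S \<inter> set (u # us) = B \<inter> S \<inter> set us"
      and 2: "S - (B \<inter> set (u # us)) = S - (B \<inter> set us)" by auto
    show ?thesis unfolding 1 2 trunc_prod_Cons if_not_P[OF False]
      using Cons.IH[OF _ Cons.prems(2,3)] Cons.prems(1) by simp
  next
    case True
    let ?T = "S - {u}" and ?d = "card (B \<inter> S \<inter> set us)"
    let ?x = "trunc_ratio vs b S u" and ?r = "ratio S u"
    let ?X = "1 / trunc_prod vs (Suc b) B ?T us" and ?Y = "Z (?T - (B \<inter> set us)) / Z ?T"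
    have fin: "finite S" using Cons.prems by (auto intro: finite_subset)
    have nz: "Z T \<noteq> 0" if "T \<subseteq> S" for T using that fin
      by (auto intro!: Z_nonzero finite_subset[OF that])
    have c1: "B \<inter> ?T \<inter> set us = B \<inter> S \<inter> set us" using Cons.prems by auto
    have "B \<inter> S \<inter> set (u # us) = insert u (B \<inter> S \<inter> set us)" using True by auto
    then have c2: "card (B \<inter> S \<inter> set (u # us)) = Suc ?d" using Cons.prems by auto
    have IH: "norm ?X \<le> M ^ ?d" "norm (?X - ?Y) \<le> real ?d * M ^ Suc ?d * e"
      using Cons.IH[of ?T] Cons.prems low_mono[of S _ ?T] unfolding c1 by auto
    have lo: "low S u" using Cons.prems True by blast
    have x: "norm (?x - 1) \<le> c / real (Suc D)" "norm (?x - ?r) \<le> e"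
      using child[of S u] Cons.prems True lo by auto
    have r: "norm (?r - 1) \<le> c / real (Suc D)"
      using ratio_bound_low fin True lo by auto
    note inv = norm_inverse_le_M(2) norm_inverse_le_M(1)
    have Yb: "norm ?Y \<le> M ^ ?d"
    proof -
      have "norm (Z (?T - (B \<inter> S \<inter> set us)) / Z ?T) \<le> M ^ ?d"
      proof (rule quotient_bound)
        show "low ?T w" if "w \<in> B \<inter> S \<inter> set us" for w
          using that Cons.prems low_mono[of S w ?T] by auto
        show "norm (ratio T w - 1) \<le> c / real (Suc D)" if "T \<subseteq> ?T" "w \<in> T" "low T w" for T w
          using that fin by (intro ratio_bound_low) (auto intro: finite_subset)
        show "Z T \<noteq> 0" if "T \<subseteq> ?T" for T using that by (intro nz) auto
      qed (use Cons.prems in auto)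
      moreover have "?T - (B \<inter> S \<inter> set us) = ?T - (B \<inter> set us)" by auto
      ultimately show ?thesis by simp
    qed
    have eX: "1 / trunc_prod vs (Suc b) B S (u # us) = ?X * (1 / ?x)"
      unfolding trunc_prod_Cons using True by simp
    have "S - (B \<inter> set (u # us)) = ?T - (B \<inter> set us)" using True by auto
    then have eY: "Z (S - (B \<inter> set (u # us))) / Z S = ?Y * (1 / ?r)"
      using nz[of ?T] by (simp add: ratio_def)
    have b1: "norm (?X * (1 / ?x)) \<le> M ^ Suc ?d"
      unfolding norm_mult power_Suc2 using IH inv(1)[OF x(1)] M_pos by (intro mult_mono) auto
    have "1 / ?x - 1 / ?r = (1 / ?x) * (1 / ?r) * (?r - ?x)"
      using inv(2)[OF x(1)] inv(2)[OF r] by (simp add: field_simps)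
    then have "norm (1 / ?x - 1 / ?r) = norm (1 / ?x) * norm (1 / ?r) * norm (?r - ?x)"
      by (simp only: norm_mult)
    also have "\<dots> \<le> M * M * e"
      using inv(1)[OF x(1)] inv(1)[OF r] x(2) M_pos e
      by (intro mult_mono) (auto simp: norm_minus_commute)
    finally have b2: "norm (1 / ?x - 1 / ?r) \<le> M * M * e" .
    \<comment> \<open>One factor is exchanged at a time: the old error d M^(d+1) e is multiplied by
      M, the new factor adds M^d M^2 e, and the sum is (d+1) M^(d+2) e.\<close>
    have ring: "p * q - r * s = (p - r) * q + r * (q - s)" for p q r s :: complex
      by (simp add: algebra_simps)
    have "norm (?X * (1 / ?x) - ?Y * (1 / ?r))
        = norm ((?X - ?Y) * (1 / ?x) + ?Y * (1 / ?x - 1 / ?r))"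
      by (rule arg_cong[OF ring])
    also have "\<dots> \<le> norm ((?X - ?Y) * (1 / ?x)) + norm (?Y * (1 / ?x - 1 / ?r))"
      by (rule norm_triangle_ineq)
    also have "\<dots> = norm (?X - ?Y) * norm (1 / ?x) + norm ?Y * norm (1 / ?x - 1 / ?r)"
      by (simp only: norm_mult)
    also have "\<dots> \<le> (real ?d * M ^ Suc ?d * e) * M + M ^ ?d * (M * M * e)"
      by (rule add_mono[OF mult_mono[OF IH(2) inv(1)[OF x(1)]] mult_mono[OF Yb b2]])
        (use M_pos e in simp_all)
    also have "\<dots> = real (Suc ?d) * M ^ Suc (Suc ?d) * e"
      by (simp add: algebra_simps)
    finally show ?thesis unfolding c2 eX eY by (rule conjI[OF b1])
  qed
qed

text \<open>The number \<open>d\<close> of factors stays a parameter: d = D gives the contracting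
  step below the root, d = D + 1 the single step at the root.\<close>

lemma trunc_ratio_step:
  assumes child: "\<And>T u. T \<subseteq> set vs \<Longrightarrow> u \<in> T \<Longrightarrow> low T u \<Longrightarrow>
      norm (trunc_ratio vs b T u - 1) \<le> c / real (Suc D) \<and>
      norm (trunc_ratio vs b T u - ratio T u) \<le> e"
    and e: "0 \<le> e" and "distinct vs" "S \<subseteq> set vs" "u \<in> S" and d: "card (N u \<inter> S) \<le> d"
  shows "norm (trunc_ratio vs (Suc b) S u - 1) \<le> norm lam * M ^ d"
    "norm (trunc_ratio vs (Suc b) S u - ratio S u) \<le> norm lam * (real d * M ^ Suc d) * e"
proof -
  let ?T = "S - {u}"
  let ?k = "card (N u \<inter> ?T \<inter> set vs)"
  let ?X = "1 / trunc_prod vs (Suc b) (N u) ?T vs"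
  have "N u \<inter> ?T \<inter> set vs = N u \<inter> S" using assms nbr_irrefl by auto
  then have k: "?k \<le> d" using d by simp
  have pow: "M ^ ?k \<le> M ^ d" "M ^ Suc ?k \<le> M ^ Suc d"
    using k M_ge by (auto intro!: power_increasing simp del: power_Suc)
  have T: "norm ?X \<le> M ^ ?k"
     "norm (?X - Z (?T - (N u \<inter> set vs)) / Z ?T) \<le> real ?k * M ^ Suc ?k * e"
    using trunc_prod_approx[OF child e, of vs ?T "N u"] assms low_nbr[of _ u ?T] by auto
  have fin: "finite S" using assms by (auto intro: finite_subset)
  have eq: "?T - (N u \<inter> set vs) = ?T - N u" using assms by auto
  have r: "ratio S u = 1 + lam * (Z (?T - N u) / Z ?T)"
    using fin assms by (intro ratio_eq Z_nonzero) auto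
  have t: "trunc_ratio vs (Suc b) S u = 1 + lam * ?X"
    by (simp add: trunc_ratio_def)
  have "norm (trunc_ratio vs (Suc b) S u - 1) = norm lam * norm ?X"
    unfolding t by (simp add: norm_mult norm_divide)
  also have "\<dots> \<le> norm lam * M ^ d"
    using T(1) pow by (intro mult_left_mono) auto
  finally show "norm (trunc_ratio vs (Suc b) S u - 1) \<le> norm lam * M ^ d" .
  have "trunc_ratio vs (Suc b) S u - ratio S u = lam * (?X - Z (?T - N u) / Z ?T)"
    unfolding r t by (simp add: algebra_simps)
  then have "norm (trunc_ratio vs (Suc b) S u - ratio S u)
      = norm lam * norm (?X - Z (?T - N u) / Z ?T)"
    by (simp only: norm_mult)
  also have "\<dots> \<le> norm lam * (real ?k * M ^ Suc ?k * e)"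
    using T(2) unfolding eq by (rule mult_left_mono) auto
  also have "\<dots> \<le> norm lam * (real d * M ^ Suc d * e)"
    using k pow M_pos e by (intro mult_left_mono mult_right_mono mult_mono) auto
  finally show "norm (trunc_ratio vs (Suc b) S u - ratio S u) \<le> norm lam * (real d * M ^ Suc d) * e"
    by (simp add: mult.assoc)
qed

text \<open>At depth 0 the truncation is 1 + \<lambda>. It lies in the disc together with the exact
  ratio, so the error is at most 2 / (D + 1) \<le> 1. Every further level keeps the disc and
  multiplies the error by \<open>c\<close>.\<close>

lemma trunc_ratio_low:
  assumes "distinct vs"
  shows "S \<subseteq> set vs \<Longrightarrow> u \<in> S \<Longrightarrow> low S u \<Longrightarrow>
    norm (trunc_ratio vs b S u - 1) \<le> c / real (Suc D) \<and>
    norm (trunc_ratio vs b S u - ratio S u) \<le> c ^ b"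
proof (induction b arbitrary: S u)
  case 0
  have "1 \<le> M ^ D" using M_ge by simp
  then have lam: "norm lam \<le> c / real (Suc D)"
    using mult_left_mono[of 1 "M ^ D" "norm lam"] lam_M by simp
  have "norm (ratio S u - 1) \<le> c / real (Suc D)"
    using 0 by (intro ratio_bound_low) (auto intro: finite_subset)
  then have "norm (lam - (ratio S u - 1)) \<le> 2 * (c / real (Suc D))"
    using norm_triangle_ineq4[of lam "ratio S u - 1"] lam by linarith
  also have "\<dots> \<le> 2 / real (Suc D)" using c_less by (simp add: divide_simps)
  also have "\<dots> \<le> 1" using D_pos by (simp add: divide_simps)
  finally show ?case using lam by (simp add: trunc_ratio_def algebra_simps)
next
  case (Suc b)
  have e: "0 \<le> c ^ b" using c_nonneg by simp
  have d: "card (N u \<inter> S) \<le> D" using Suc.prems by (simp add: low_def)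
  note step = trunc_ratio_step[OF Suc.IH e assms Suc.prems(1,2) d]
  show ?case
    by (rule conjI[OF step(1)[unfolded lam_M] step(2)[unfolded lam_contract, folded power_Suc]])
qed

text \<open>Here \<open>u\<close> may be a root, hence a constant in front of c^b that does not
  depend on the graph. The error can be made relative since the exact ratio has modulus at least 1 -
  c.\<close>

lemma trunc_ratio_rel_error:
  assumes "distinct vs" "S \<subseteq> set vs" "u \<in> S"
  shows "ratio S u \<noteq> 0"
    "norm (trunc_ratio vs (Suc b) S u / ratio S u - 1)
       \<le> norm lam * (real (Suc D) * M ^ Suc (Suc D)) / (1 - c) * c ^ b"
proof -
  have fin: "finite S" using assms by (auto intro: finite_subset)
  have "c / real D \<le> c" using frac_le[of c c 1 "real D"] c_nonneg D_pos by simp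
  then have "norm (ratio S u - 1) \<le> c" using ratio_bound[OF fin assms(3)] by linarith
  moreover have "1 \<le> norm (ratio S u) + norm (ratio S u - 1)"
    using norm_triangle_ineq4[of "ratio S u" "ratio S u - 1"] by simp
  ultimately have r: "1 - c \<le> norm (ratio S u)" by linarith
  then show nz: "ratio S u \<noteq> 0" using c_less by auto
  have d: "card (N u \<inter> S) \<le> Suc D"
    using degree[of u] card_mono[OF finite_nbr, of "N u \<inter> S" u] by auto
  have e: "0 \<le> c ^ b" using c_nonneg by simp
  let ?E = "norm lam * (real (Suc D) * M ^ Suc (Suc D)) * c ^ b"
  have E: "norm (trunc_ratio vs (Suc b) S u - ratio S u) \<le> ?E"
    by (rule trunc_ratio_step[OF trunc_ratio_low[OF assms(1)] e assms d])
  have "norm (trunc_ratio vs (Suc b) S u / ratio S u - 1)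
      = norm (trunc_ratio vs (Suc b) S u - ratio S u) / norm (ratio S u)"
    using nz by (simp add: norm_divide[symmetric] diff_divide_distrib)
  also have "\<dots> \<le> ?E / (1 - c)"
    by (rule frac_le[OF order_trans[OF norm_ge_zero E] E _ r]) (use c_less in simp)
  finally show "norm (trunc_ratio vs (Suc b) S u / ratio S u - 1)
       \<le> norm lam * (real (Suc D) * M ^ Suc (Suc D)) / (1 - c) * c ^ b"
    by simp
qed

end

section \<open>Relative error of the product over all vertices\<close>

lemma norm_mult_diff_one:
  fixes x y :: complex
  assumes "norm (x - 1) \<le> a" "norm (y - 1) \<le> b"
  shows "norm (x * y - 1) \<le> (1 + a) * (1 + b) - 1"
proof -
  have "x * y - 1 = (x - 1) * (y - 1) + (x - 1) + (y - 1)" by (simp add: algebra_simps)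
  then have "norm (x * y - 1) \<le> norm (x - 1) * norm (y - 1) + norm (x - 1) + norm (y - 1)"
    by (metis norm_mult norm_triangle_le norm_triangle_mono order_refl)
  also have "\<dots> \<le> a * b + a + b"
    using assms norm_ge_zero[of "x - 1"] norm_ge_zero[of "y - 1"]
    by (intro add_mono mult_mono) linarith+
  finally show ?thesis by (simp add: algebra_simps)
qed

context indep_graph begin

text \<open>With \<open>B = UNIV\<close> every scanned vertex is deleted, so the exact product
  telescopes, and the relative errors multiply. The lemma asks only for accurate non-zero ratios and
  so covers the contraction and the matching case alike.\<close>

lemma trunc_prod_rel_error:
  assumes "\<And>S u. S \<subseteq> set vs \<Longrightarrow> u \<in> S \<Longrightarrow>
      ratio S u \<noteq> 0 \<and> norm (trunc_ratio vs b S u / ratio S u - 1) \<le> \<eta>"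
    and "0 \<le> \<eta>"
  shows "distinct us \<Longrightarrow> set us \<subseteq> S \<Longrightarrow> S \<subseteq> set vs \<Longrightarrow> Z (S - set us) \<noteq> 0 \<Longrightarrow> Z S \<noteq> 0 \<and>
    norm (trunc_prod vs (Suc b) UNIV S us / (Z S / Z (S - set us)) - 1) \<le> (1 + \<eta>) ^ length us - 1"
proof (induction us arbitrary: S)
  case (Cons u us)
  let ?T = "S - {u}"
  have eq: "?T - set us = S - set (u # us)" by auto
  have IH: "Z ?T \<noteq> 0" "norm (trunc_prod vs (Suc b) UNIV ?T us / (Z ?T / Z (S - set (u # us))) - 1)
      \<le> (1 + \<eta>) ^ length us - 1"
    using Cons.IH[of ?T] Cons.prems unfolding eq by auto
  have u: "ratio S u \<noteq> 0" "norm (trunc_ratio vs b S u / ratio S u - 1) \<le> \<eta>"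
    using assms(1)[of S u] Cons.prems by auto
  have nz: "Z S \<noteq> 0" using u(1) by (auto simp: ratio_def)
  have "trunc_prod vs (Suc b) UNIV S (u # us) / (Z S / Z (S - set (u # us)))
      = (trunc_ratio vs b S u / ratio S u) *
        (trunc_prod vs (Suc b) UNIV ?T us / (Z ?T / Z (S - set (u # us))))"
    unfolding trunc_prod_Cons using Cons.prems IH(1) nz by (simp add: ratio_def)
  then show ?case using norm_mult_diff_one[OF u(2) IH(2)] nz by simp
qed simp

end

section \<open>Maximum degree one\<close>

context indep_graph begin

lemma trunc_prod_disjoint: "B \<inter> S \<inter> set us = {} \<Longrightarrow> trunc_prod vs b B S us = 1"
proof (induction us)
  case Nil
  then show ?case by (cases b) auto
next
  case (Cons u us)
  then show ?case by (cases b) auto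
qed

lemma trunc_prod_single:
  "B \<inter> S = {w} \<Longrightarrow> w \<in> set us \<Longrightarrow> trunc_prod vs (Suc b) B S us = trunc_ratio vs b S w"
proof (induction us)
  case (Cons u us)
  show ?case
  proof (cases "u = w")
    case True
    have "trunc_prod vs (Suc b) B (S - {w}) us = 1"
      using Cons.prems by (intro trunc_prod_disjoint) auto
    then show ?thesis using True Cons.prems by (simp add: trunc_ratio_def)
  next
    case False
    then have "u \<notin> B \<inter> S" "w \<in> set us" using Cons.prems by auto
    then show ?thesis using Cons by (simp only: trunc_prod_Cons if_False)
  qed
qed simp

text \<open>For a matching the recursion reaches its leaves after two steps, so truncation is exact.\<close>

lemma trunc_ratio_matching:
  assumes deg: "\<And>v. card (N v) \<le> 1" and fin: "\<And>v. finite (N v)"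
    and lam: "norm lam < 1" "lam \<noteq> - 1 / 2"
    and S: "S \<subseteq> set vs" "u \<in> S"
  shows "ratio S u \<noteq> 0 \<and> trunc_ratio vs (Suc b) S u = ratio S u"
proof -
  \<comment> \<open>The independence polynomials of a single vertex and a single edge are 1 +
    \<lambda> and 1 + 2 \<lambda>; the only ratios that occur are 1 + \<lambda> and (1 + 2
    \<lambda>) / (1 + \<lambda>).\<close>
  have nz1: "1 + lam \<noteq> 0"
  proof
    assume "1 + lam = 0"
    then have "lam = - 1" by (simp add: add_eq_0_iff)
    then show False using lam by simp
  qed
  have nz2: "1 + lam / (1 + lam) \<noteq> 0"
  proof
    assume "1 + lam / (1 + lam) = 0"
    then have "1 + lam * 2 = 0" using nz1 by (simp add: field_simps)
    then have "lam * 2 = - 1" by (simp only: add_eq_0_iff)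
    then have "lam = - 1 / 2" by (simp add: field_simps)
    then show False using lam by simp
  qed
  \<comment> \<open>Used twice: its first half drives the induction for non-vanishing, whose result
    then discharges the premise on \<open>Z (T - {v})\<close> for the second half.\<close>
  have main: "ratio T v \<noteq> 0 \<and> (T \<subseteq> set vs \<longrightarrow> trunc_ratio vs (Suc b) T v = ratio T v)"
    if T: "finite T" "v \<in> T" "Z (T - {v}) \<noteq> 0" for T v
  proof (cases "N v \<inter> (T - {v}) = {}")
    case True
    then have "T - {v} - N v = T - {v}" by auto
    then have "ratio T v = 1 + lam" using ratio_eq[OF T] T by simp
    moreover have "trunc_prod vs (Suc b) (N v) (T - {v}) vs = 1"
      by (rule trunc_prod_disjoint) (use True in auto)
    ultimately show ?thesis using nz1 by (simp add: trunc_ratio_def)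
  next
    case False
    then obtain w where w: "w \<in> N v" "w \<in> T" "w \<noteq> v" by auto
    have "N x = {y}" if "y \<in> N x" for x y
      using card_seteq[of "N x" "{y}"] that deg[of x] fin by auto
    then have Nv: "N v = {w}" and Nw: "N w = {v}" using w nbr_sym by auto
    let ?U = "T - {v} - {w}"
    have Uw: "?U - N w = ?U" using Nw by auto
    have Z: "Z (T - {v}) = (1 + lam) * Z ?U"
      using Z_rec[of "T - {v}" w] w T unfolding Uw by (simp add: algebra_simps)
    then have "Z ?U \<noteq> 0" using T by auto
    then have r: "ratio T v = 1 + lam / (1 + lam)"
      using ratio_eq[OF T] nz1 by (simp add: Nv Z)
    have "trunc_ratio vs (Suc b) T v = ratio T v" if "T \<subseteq> set vs"
    proof -
      have "trunc_prod vs (Suc b) (N v) (T - {v}) vs = trunc_ratio vs b (T - {v}) w"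
        by (rule trunc_prod_single) (use w Nv that in auto)
      moreover have "trunc_prod vs b (N w) ?U vs = 1"
        by (rule trunc_prod_disjoint) (use Nw in auto)
      ultimately show ?thesis unfolding r by (simp add: trunc_ratio_def)
    qed
    then show ?thesis using r nz2 by auto
  qed
  have "Z T \<noteq> 0" if "finite T" for T
    using that
  proof (induction T rule: finite_psubset_induct)
    case (psubset T)
    show ?case
    proof (cases "T = {}")
      case False
      then obtain v where v: "v \<in> T" by auto
      then have "Z (T - {v}) \<noteq> 0" by (intro psubset.IH) auto
      then have "ratio T v \<noteq> 0" using main[OF psubset.hyps v] by blast
      then show ?thesis by (auto simp: ratio_def)
    qed simp
  qed
  moreover have "finite S" using S by (auto intro: finite_subset)
  ultimately show ?thesis using main[of S u] S by auto
qed

end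

section \<open>Convergence at a rate independent of the graph\<close>

lemma lambda_star_Suc: "lambda_star (Suc d) = real d ^ d / real (Suc d) ^ Suc d"
  by (simp add: lambda_star_def)

text \<open>The rate \<open>c\<close> becomes 1/2 by grouping \<open>m\<close> levels with c^m <
  1/2, so that a program can choose the depth by counting doublings. \<open>C\<close> and
  \<open>m\<close> depend on \<Delta> and \<lambda> alone. In the matching case both are 0, since
  one level beyond the root ratio is already exact.\<close>

lemma trunc_ratio_converges:
  assumes "norm lam < lambda_star \<Delta>" "\<Delta> = 1 \<Longrightarrow> lam \<noteq> - 1 / 2"
  shows "\<exists>(C :: real) m. 0 \<le> C \<and> (\<forall>(N :: nat \<Rightarrow> nat set) vs S u k. indep_graph N \<longrightarrow> (\<forall>v. finite (N v) \<and> card (N v) \<le> \<Delta>) \<longrightarrow>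
    distinct vs \<longrightarrow> S \<subseteq> set vs \<longrightarrow> u \<in> S \<longrightarrow> indep_graph.ratio N lam S u \<noteq> 0 \<and>
    norm (indep_graph.trunc_ratio N lam vs (Suc (m * k)) S u / indep_graph.ratio N lam S u - 1) \<le> C / 2 ^ k)"
proof (cases \<Delta>)
  case 0
  then have "norm lam < - 1" using assms(1) by (simp add: lambda_star_def power_int_def)
  then show ?thesis using norm_ge_zero[of lam] by linarith
next
  case (Suc D)
  show ?thesis
  proof (cases "D = 0")
    case True
    have lam: "norm lam < 1" "lam \<noteq> - 1 / 2"
      using assms Suc True by (auto simp: lambda_star_def)
    have "indep_graph.ratio N lam S u \<noteq> 0 \<and>
      norm (indep_graph.trunc_ratio N lam vs (Suc (0 * k)) S u / indep_graph.ratio N lam S u - 1) \<le> 0 / 2 ^ k"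
      if "indep_graph N" "\<forall>v. finite (N v) \<and> card (N v) \<le> \<Delta>" "S \<subseteq> set vs" "u \<in> S"
      for N :: "nat \<Rightarrow> nat set" and vs S u k
    proof -
      interpret indep_graph N lam by fact
      show ?thesis
        using trunc_ratio_matching[of S vs u "0 * k"] lam that Suc True by simp
    qed
    then show ?thesis by (intro exI[of _ 0] exI[of _ 0]) simp
  next
    case False
    define M where "M = real (Suc D) / real D"
    define c where "c = norm lam * real (Suc D) * M ^ D"
    have c0: "0 \<le> c" by (simp add: c_def M_def)
    have "M ^ D = real (Suc D) ^ D / real D ^ D" by (simp add: M_def power_divide)
    \<comment> \<open>Hence \<open>c\<close> is |\<lambda>| divided by
      \<open>lambda_star \<Delta>\<close>, and the hypothesis says precisely c < 1.\<close>
    then have "lambda_star \<Delta> * (real (Suc D) * M ^ D) = 1"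
      using False by (simp add: Suc lambda_star_Suc del: of_nat_Suc)
    moreover have "norm lam * (real (Suc D) * M ^ D) < lambda_star \<Delta> * (real (Suc D) * M ^ D)"
      using assms(1) False by (intro mult_strict_right_mono) (auto simp: M_def)
    ultimately have c1: "c < 1" by (simp add: c_def mult.assoc)
    obtain m where m: "c ^ m < 1 / 2" using real_arch_pow_inv[of "1 / 2" c] c1 by auto
    define C where "C = norm lam * (real (Suc D) * M ^ Suc (Suc D)) / (1 - c)"
    have C: "0 \<le> C" using c1 by (simp add: C_def M_def)
    have "indep_graph.ratio N lam S u \<noteq> 0 \<and>
      norm (indep_graph.trunc_ratio N lam vs (Suc (m * k)) S u / indep_graph.ratio N lam S u - 1) \<le> C / 2 ^ k"
      if "indep_graph N" "\<forall>v. finite (N v) \<and> card (N v) \<le> \<Delta>" "distinct vs" "S \<subseteq> set vs" "u \<in> S"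
      for N :: "nat \<Rightarrow> nat set" and vs S u k
    proof -
      interpret indep_graph N lam by fact
      interpret indep_graph_bounded N lam D M c
        by unfold_locales (use that Suc False c1 in \<open>auto simp: M_def c_def\<close>)
      have "c ^ (m * k) \<le> (1 / 2) ^ k"
        unfolding power_mult using m c0 by (intro power_mono) auto
      from mult_left_mono[OF this C] have "C * c ^ (m * k) \<le> C / 2 ^ k"
        by (simp add: power_divide)
      then show ?thesis
        using trunc_ratio_rel_error(1)[OF that(3-5)] trunc_ratio_rel_error(2)[OF that(3-5), of "m * k"]
        unfolding C_def by linarith
    qed
    then show ?thesis using C by blast
  qed
qed

section \<open>Running times of programs\<close>

primrec straight :: "com \<Rightarrow> bool" where
  "straight Skip = True"
| "straight (NAssign a e) = True"
| "straight (CAssign a e) = True"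
| "straight (Seq p q) = (straight p \<and> straight q)"
| "straight (Ite b p q) = (straight p \<and> straight q)"
| "straight (While b p) = False"

text \<open>A functional semantics for loop-free code, so that loop bodies can be verified by
  simplification; the value at \<open>While\<close> is a dummy.\<close>

primrec step :: "com \<Rightarrow> state \<Rightarrow> state" where
  "step Skip s = s"
| "step (NAssign a e) s = ((fst s)(nval a s := nval e s), snd s)"
| "step (CAssign a e) s = (fst s, (snd s)(nval a s := cval e s))"
| "step (Seq p q) s = step q (step p s)"
| "step (Ite b p q) s = (if bval b s then step p s else step q s)"
| "step (While b p) s = s"

text \<open>Adding both branches of \<open>Ite\<close> makes the bound depend on the program text
  alone. A loop is charged for one pass; the number of passes enters later as a factor.\<close>

primrec time_bound :: "com \<Rightarrow> nat" where
  "time_bound Skip = 1"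
| "time_bound (NAssign a e) = 1 + ncost a + ncost e"
| "time_bound (CAssign a e) = 1 + ncost a + ccost e"
| "time_bound (Seq p q) = time_bound p + time_bound q"
| "time_bound (Ite b p q) = 1 + bcost b + time_bound p + time_bound q"
| "time_bound (While b p) = 1 + bcost b + time_bound p"

lemma exec_straight: "straight p \<Longrightarrow> \<exists>t\<le>time_bound p. exec p s t (step p s)"
proof (induction p arbitrary: s)
  case Skip
  then show ?case using exec.Skip[of s] by auto
next
  case (NAssign a e)
  then show ?case using exec.NAssign[of a e s] by auto
next
  case (CAssign a e)
  then show ?case using exec.CAssign[of a e s] by auto
next
  case (Seq p q)
  obtain t where t: "t \<le> time_bound p" "exec p s t (step p s)"
    using Seq.IH(1)[of s] Seq.prems by auto
  obtain u where u: "u \<le> time_bound q" "exec q (step p s) u (step q (step p s))"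
    using Seq.IH(2)[of "step p s"] Seq.prems by auto
  show ?case
    by (rule exI[of _ "t + u"]) (use t u exec.Seq[OF t(2) u(2)] in simp)
next
  case (Ite b p q)
  obtain t where t: "t \<le> time_bound p" "exec p s t (step p s)"
    using Ite.IH(1)[of s] Ite.prems by auto
  obtain u where u: "u \<le> time_bound q" "exec q s u (step q s)"
    using Ite.IH(2)[of s] Ite.prems by auto
  show ?case
  proof (cases "bval b s")
    case True
    then show ?thesis using t exec.IteTrue[OF True t(2)]
      by (intro exI[of _ "1 + bcost b + t"]) auto
  next
    case False
    then show ?thesis using u exec.IteFalse[OF False u(2)]
      by (intro exI[of _ "1 + bcost b + u"]) auto
  qed
qed simp

definition terminates :: "com \<Rightarrow> state \<Rightarrow> nat \<Rightarrow> (state \<Rightarrow> bool) \<Rightarrow> bool" where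
  "terminates p s T Q \<longleftrightarrow> (\<exists>t s'. exec p s t s' \<and> t \<le> T \<and> Q s')"

lemma terminates_straight: "straight p \<Longrightarrow> Q (step p s) \<Longrightarrow> terminates p s (time_bound p) Q"
  unfolding terminates_def using exec_straight by blast

lemma terminates_Seq:
  assumes "terminates p s T Q" "\<And>s'. Q s' \<Longrightarrow> terminates q s' U Q'"
  shows "terminates (Seq p q) s (T + U) Q'"
  using assms unfolding terminates_def by (meson add_mono exec.Seq)

definition iteration_time :: "bexp \<Rightarrow> com \<Rightarrow> nat" where
  "iteration_time b p = 1 + bcost b + time_bound p"

text \<open>The invariant is indexed by the exact number of passes still to come, so it supplies
  termination and running time at once. The extra summand in \<open>Suc k\<close> pays for the final
  failing test.\<close>

lemma terminates_While:
  assumes "straight p"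
    and "\<And>k s. I (Suc k) s \<Longrightarrow> bval b s \<and> I k (step p s)"
    and "\<And>s. I 0 s \<Longrightarrow> \<not> bval b s"
  shows "I k s \<Longrightarrow> terminates (While b p) s (Suc k * iteration_time b p) (I 0)"
proof (induction k arbitrary: s)
  case 0
  then have "exec (While b p) s (1 + bcost b) s"
    using assms(3) exec.WhileFalse by blast
  then show ?case unfolding terminates_def using 0
    by (intro exI[of _ "1 + bcost b"] exI[of _ s]) (auto simp: iteration_time_def)
next
  case (Suc k)
  obtain t where t: "t \<le> time_bound p" "exec p s t (step p s)"
    using exec_straight[OF assms(1)] by blast
  obtain u s' where u: "exec (While b p) (step p s) u s'" "u \<le> Suc k * iteration_time b p" "I 0 s'"
    using Suc.IH assms(2)[OF Suc.prems] unfolding terminates_def by blast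
  have "exec (While b p) s (1 + bcost b + t + u) s'"
    using assms(2)[OF Suc.prems] t u by (blast intro: exec.WhileTrue)
  then show ?case unfolding terminates_def using t u
    by (intro exI[of _ "1 + bcost b + t + u"] exI[of _ s']) (auto simp: iteration_time_def)
qed

section \<open>Depth-first evaluation of the truncated recursion\<close>

text \<open>The configuration \<open>(b, V, J, R, M, P)\<close> of the depth-first evaluation of \<open>trunc_prod\<close>. Frame
  \<open>b\<close> of the stack is the call with remaining depth \<open>b\<close>: \<open>V b\<close> points to the adjacency row of its
  vertex, \<open>J b\<close> is the vertex being scanned, \<open>R b\<close> points to the row of \<open>J b\<close>, and \<open>P b\<close> is the
  partial product. A vertex deleted by frame \<open>b\<close> carries the mark \<open>b + 1\<close>; once \<open>J b\<close> has reached
  \<open>n\<close>, a second sweep with \<open>n \<le> J b < 2 n\<close> clears these marks again. The frame \<open>top\<close> plays the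
  role of an additional vertex adjacent to all others, so that its product telescopes to
  \<open>Z\<close> of the whole graph.\<close>

type_synonym config =
  "nat \<times> (nat \<Rightarrow> nat) \<times> (nat \<Rightarrow> nat) \<times> (nat \<Rightarrow> nat) \<times> (nat \<Rightarrow> real) \<times> (nat \<Rightarrow> complex)"

text \<open>Adjacency is queried by address in the row-major matrix, because the machine reaches a
  row only through a pointer obtained by repeated addition of \<open>n\<close>.\<close>

locale search = indep_graph N lam for N :: "nat \<Rightarrow> nat set" and lam :: complex +
  fixes n top :: nat and A :: "nat \<Rightarrow> bool" and \<Delta> :: nat
  assumes nbr: "v < n \<Longrightarrow> N v = {j. j < n \<and> A (1 + v * n + j)}"
    and card_nbr: "card (N v) \<le> \<Delta>"
begin

definition active :: "config \<Rightarrow> bool" where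
  "active = (\<lambda>(b, V, J, R, M, P). b < top \<or> J b < n)"

text \<open>The test \<open>0 < b\<close> implements truncation: frame 0 only scans and returns the
  product 1. Marks are real because they live in complex memory, which also holds the matrix copy
  and is compared through real parts.\<close>

definition next_config :: "config \<Rightarrow> config" where
  "next_config = (\<lambda>(b, V, J, R, M, P).
     if J b < n then
       if (A (V b + J b) \<or> \<not> b < top) \<and> \<not> 0 < M (J b) \<and> 0 < b then
         (b - 1, V(b - 1 := R b), J(b := J b + 1, b - 1 := 0), R(b := R b + n, b - 1 := 1),
          M(J b := real (b + 1)), P(b - 1 := 1))
       else (b, V, J(b := J b + 1), R(b := R b + n), M, P)
     else if J b < n + n then
       (b, V, J(b := J b + 1), R,
        if M (J b - n) < real (b + 2) then M(J b - n := 0) else M, P)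
     else (b + 1, V, J, R, M, P(b + 1 := P (b + 1) * (1 + lam / P b))))"

inductive reach :: "nat \<Rightarrow> config \<Rightarrow> config \<Rightarrow> bool" where
  refl: "reach 0 x x"
| Suc: "active x \<Longrightarrow> reach k (next_config x) y \<Longrightarrow> reach (Suc k) x y"

lemma reach_trans: "reach k x y \<Longrightarrow> reach l y z \<Longrightarrow> reach (k + l) x z"
  by (induction rule: reach.induct) (auto intro: reach.intros)

definition unmarked :: "(nat \<Rightarrow> real) \<Rightarrow> nat set" where
  "unmarked M = {i. i < n \<and> M i = 0}"

text \<open>The contract of a call by frame b + 1. The caller has already marked \<open>v\<close>,
  with b + 2, so all marks present are at least b + 2. The call must restore the marks exactly and
  leave the frames above it intact, apart from multiplying one ratio into the caller's product.
  Frames up to \<open>b\<close> may be left in any state.\<close>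

definition call_spec :: "nat \<Rightarrow> nat \<Rightarrow> bool" where
  "call_spec b \<tau> \<longleftrightarrow> (\<forall>v V J R M P. v < n \<longrightarrow> M v \<noteq> 0 \<longrightarrow> V b = 1 + v * n \<longrightarrow> J b = 0 \<longrightarrow> R b = 1 \<longrightarrow> P b = 1 \<longrightarrow>
     (\<forall>i. M i = 0 \<or> real (b + 2) \<le> M i) \<longrightarrow>
     (\<exists>k V' J' R' P'. reach k (b, V, J, R, M, P) (Suc b, V', J', R', M, P') \<and>
        (\<forall>i>b. V' i = V i \<and> J' i = J i \<and> R' i = R i) \<and> (\<forall>i>Suc b. P' i = P i) \<and>
        P' (Suc b) = P (Suc b) * trunc_ratio [0..<n] b (insert v (unmarked M)) v \<and> k \<le> \<tau>))"

lemma call_specD: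
  assumes "call_spec b \<tau>" "v < n" "M v \<noteq> 0" "V b = 1 + v * n" "J b = 0" "R b = 1" "P b = 1"
    "\<forall>i. M i = 0 \<or> real (b + 2) \<le> M i"
  shows "\<exists>k V' J' R' P'. reach k (b, V, J, R, M, P) (Suc b, V', J', R', M, P') \<and>
        (\<forall>i>b. V' i = V i \<and> J' i = J i \<and> R' i = R i) \<and> (\<forall>i>Suc b. P' i = P i) \<and>
        P' (Suc b) = P (Suc b) * trunc_ratio [0..<n] b (insert v (unmarked M)) v \<and> k \<le> \<tau>"
  using assms unfolding call_spec_def by blast

text \<open>Scanning from \<open>j\<close> reproduces \<open>trunc_prod\<close> on the remaining
  vertices, because the contract lets each call return with the marks as they were at its start. The
  case b = top is included, with \<open>B\<close> then containing every index below
  \<open>n\<close>.\<close>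

lemma scan:
  assumes call: "0 < b \<Longrightarrow> call_spec (b - 1) \<tau>" and b: "b \<le> top"
  shows "J b = j \<Longrightarrow> j \<le> n \<Longrightarrow> R b = 1 + j * n \<Longrightarrow>
    (\<forall>i<n. i \<in> B \<longleftrightarrow> A (V b + i) \<or> \<not> b < top) \<Longrightarrow> (\<forall>i. M i = 0 \<or> real (b + 1) \<le> M i) \<Longrightarrow>
    \<exists>k V' J' R' P'. reach k (b, V, J, R, M, P) (b, V', J', R',
         \<lambda>i. if i \<in> B \<and> j \<le> i \<and> i < n \<and> M i = 0 \<and> 0 < b then real (b + 1) else M i, P') \<and>
       J' b = n \<and> V' b = V b \<and>
       (\<forall>i>b. V' i = V i \<and> J' i = J i \<and> R' i = R i \<and> P' i = P i) \<and>
       P' b = P b * trunc_prod [0..<n] b B (unmarked M) [j..<n] \<and>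
       k \<le> (n - j) + \<tau> * card (B \<inter> {j..<n})"
proof (induction "n - j" arbitrary: j V J R M P)
  case 0
  then have "j = n" by simp
  have M: "(\<lambda>i. if i \<in> B \<and> j \<le> i \<and> i < n \<and> M i = 0 \<and> 0 < b then real (b + 1) else M i) = M"
    using \<open>j = n\<close> by auto
  have r: "reach 0 (b, V, J, R, M, P) (b, V, J, R,
     \<lambda>i. if i \<in> B \<and> j \<le> i \<and> i < n \<and> M i = 0 \<and> 0 < b then real (b + 1) else M i, P)"
    unfolding M by (rule reach.refl)
  have "trunc_prod [0..<n] b B (unmarked M) [j..<n] = 1"
    using \<open>j = n\<close> by (cases b) auto
  then have Q: "P b = P b * trunc_prod [0..<n] b B (unmarked M) [j..<n]" by simp
  have "J b = n" using 0 \<open>j = n\<close> by simp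
  with r Q show ?case by blast
next
  case (Suc d)
  then have j: "j < n" and d: "d = n - Suc j" "Suc j \<le> n" by auto
  have upt: "[j..<n] = j # [Suc j..<n]" using j by (rule upt_conv_Cons)
  have act: "active (b, V, J, R, M, P)" using j Suc.prems by (simp add: active_def)
  have inB: "j \<in> B \<longleftrightarrow> A (V b + j) \<or> \<not> b < top" using Suc.prems j by blast
  have mark: "\<not> 0 < M j \<longleftrightarrow> M j = 0" using Suc.prems(5)[rule_format, of j] by auto
  have split: "B \<inter> {j..<n} = (if j \<in> B then insert j (B \<inter> {Suc j..<n}) else B \<inter> {Suc j..<n})"
    using j by (auto simp: Suc_le_eq order_le_less)
  show ?case
  proof (cases "j \<in> B \<and> M j = 0 \<and> 0 < b")
    case False
    let ?J = "J(b := J b + 1)" and ?R = "R(b := R b + n)"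
    have nx: "next_config (b, V, J, R, M, P) = (b, V, ?J, ?R, M, P)"
      using False inB mark Suc.prems j by (auto simp: next_config_def)
    obtain k V' J' R' P' where k: "reach k (b, V, ?J, ?R, M, P) (b, V', J', R',
         \<lambda>i. if i \<in> B \<and> Suc j \<le> i \<and> i < n \<and> M i = 0 \<and> 0 < b then real (b + 1) else M i, P')"
       "J' b = n" "V' b = V b"
       "\<forall>i>b. V' i = V i \<and> J' i = ?J i \<and> R' i = ?R i \<and> P' i = P i"
       "P' b = P b * trunc_prod [0..<n] b B (unmarked M) [Suc j..<n]"
       "k \<le> (n - Suc j) + \<tau> * card (B \<inter> {Suc j..<n})"
      using Suc.hyps(1)[OF d(1), of ?J ?R V M P] Suc.prems d by auto
    have M: "(\<lambda>i. if i \<in> B \<and> Suc j \<le> i \<and> i < n \<and> M i = 0 \<and> 0 < b then real (b + 1) else M i)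
      = (\<lambda>i. if i \<in> B \<and> j \<le> i \<and> i < n \<and> M i = 0 \<and> 0 < b then real (b + 1) else M i)"
      using False by (auto simp: fun_eq_iff Suc_le_eq order_le_less)
    have Q: "trunc_prod [0..<n] b B (unmarked M) [j..<n] = trunc_prod [0..<n] b B (unmarked M) [Suc j..<n]"
      using False j by (cases b) (auto simp: upt unmarked_def)
    have "card (B \<inter> {Suc j..<n}) \<le> card (B \<inter> {j..<n})" by (rule card_mono) auto
    then have "\<tau> * card (B \<inter> {Suc j..<n}) \<le> \<tau> * card (B \<inter> {j..<n})" by simp
    then have t: "Suc k \<le> (n - j) + \<tau> * card (B \<inter> {j..<n})"
      using k(6) j by linarith
    have r: "reach (Suc k) (b, V, J, R, M, P) (b, V', J', R',
         \<lambda>i. if i \<in> B \<and> j \<le> i \<and> i < n \<and> M i = 0 \<and> 0 < b then real (b + 1) else M i, P')"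
      using reach.Suc[OF act, unfolded nx, OF k(1)[unfolded M]] .
    have above: "\<forall>i>b. V' i = V i \<and> J' i = J i \<and> R' i = R i \<and> P' i = P i"
      using k(4) by auto
    have P: "P' b = P b * trunc_prod [0..<n] b B (unmarked M) [j..<n]"
      unfolding Q by (rule k(5))
    from r k(2,3) above P t show ?thesis by blast
  next
    case True
    then obtain b' where b': "b = Suc b'" by (cases b) auto
    let ?V = "V(b' := R b)" and ?J = "J(b := J b + 1, b' := 0)"
      and ?R = "R(b := R b + n, b' := 1)" and ?M = "M(j := real (b + 1))" and ?P = "P(b' := 1)"
    have nx: "next_config (b, V, J, R, M, P) = (b', ?V, ?J, ?R, ?M, ?P)"
      using True inB mark Suc.prems j b' by (auto simp: next_config_def)
    have um: "insert j (unmarked ?M) = unmarked M" "unmarked ?M = unmarked M - {j}"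
      using True j by (auto simp: unmarked_def)
    have marks: "\<forall>i. ?M i = 0 \<or> real (b + 1) \<le> ?M i" using Suc.prems(5) by auto
    have cs: "call_spec b' \<tau>" using call b' by simp
    have marks': "\<forall>i. ?M i = 0 \<or> real (b' + 2) \<le> ?M i" using marks b' by simp
    obtain k V1 J1 R1 P1 where k: "reach k (b', ?V, ?J, ?R, ?M, ?P) (Suc b', V1, J1, R1, ?M, P1)"
       "\<forall>i>b'. V1 i = ?V i \<and> J1 i = ?J i \<and> R1 i = ?R i" "\<forall>i>Suc b'. P1 i = ?P i"
       "P1 (Suc b') = ?P (Suc b') * trunc_ratio [0..<n] b' (insert j (unmarked ?M)) j" "k \<le> \<tau>"
      using call_specD[OF cs j, of ?M ?V ?J ?R ?P] Suc.prems(3) marks' b' by auto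
    have ih: "J1 b = Suc j" "R1 b = 1 + Suc j * n" "\<forall>i<n. (i \<in> B) = (A (V1 b + i) \<or> \<not> b < top)"
      using k(2)[rule_format, of b] Suc.prems b' by auto
    obtain l V' J' R' P' where l: "reach l (b, V1, J1, R1, ?M, P1) (b, V', J', R',
         \<lambda>i. if i \<in> B \<and> Suc j \<le> i \<and> i < n \<and> ?M i = 0 \<and> 0 < b then real (b + 1) else ?M i, P')"
       "J' b = n" "V' b = V1 b"
       "\<forall>i>b. V' i = V1 i \<and> J' i = J1 i \<and> R' i = R1 i \<and> P' i = P1 i"
       "P' b = P1 b * trunc_prod [0..<n] b B (unmarked ?M) [Suc j..<n]"
       "l \<le> (n - Suc j) + \<tau> * card (B \<inter> {Suc j..<n})"
      using Suc.hyps(1)[where j = "Suc j" and V = V1 and J = J1 and R = R1 and M = ?M and P = P1,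
          OF d(1) ih(1) d(2) ih(2,3) marks]
      by blast
    have M: "(\<lambda>i. if i \<in> B \<and> Suc j \<le> i \<and> i < n \<and> ?M i = 0 \<and> 0 < b then real (b + 1) else ?M i)
      = (\<lambda>i. if i \<in> B \<and> j \<le> i \<and> i < n \<and> M i = 0 \<and> 0 < b then real (b + 1) else M i)"
      using True j by (auto simp: fun_eq_iff Suc_le_eq order_le_less)
    have "j \<in> B \<inter> unmarked M" using True j by (auto simp: unmarked_def)
    then have Q: "trunc_prod [0..<n] b B (unmarked M) [j..<n]
       = trunc_ratio [0..<n] b' (unmarked M) j * trunc_prod [0..<n] b B (unmarked M - {j}) [Suc j..<n]"
      by (simp only: upt b' trunc_prod_Cons if_P)
    have P: "P' b = P b * trunc_prod [0..<n] b B (unmarked M) [j..<n]"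
      using l(5) k(4)[unfolded um(1)] b' unfolding Q um(2) by simp
    have "card (B \<inter> {j..<n}) = Suc (card (B \<inter> {Suc j..<n}))" using split True by simp
    then have t: "Suc (k + l) \<le> (n - j) + \<tau> * card (B \<inter> {j..<n})"
      using k(5) l(6) j by simp
    have r: "reach (Suc (k + l)) (b, V, J, R, M, P) (b, V', J', R',
         \<lambda>i. if i \<in> B \<and> j \<le> i \<and> i < n \<and> M i = 0 \<and> 0 < b then real (b + 1) else M i, P')"
      using reach.Suc[OF act, unfolded nx, OF reach_trans[OF k(1)[folded b'] l(1)[unfolded M]]] .
    have above: "\<forall>i>b. V' i = V i \<and> J' i = J i \<and> R' i = R i \<and> P' i = P i"
      using l(4) k(2,3) b' by auto
    have "V' b = V b" using l(3) k(2) b' by auto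
    with r above P t l(2) show ?thesis by blast
  qed
qed

text \<open>The threshold separates the marks b + 1 of frame \<open>b\<close> from those of the
  frames above, which are at least b + 2. Below the top frame the loop stays active whatever the
  scan position is.\<close>

lemma unmark:
  assumes "b < top"
  shows "j \<le> n \<Longrightarrow> J b = n + j \<Longrightarrow>
    reach (n - j) (b, V, J, R, M, P) (b, V, J(b := n + n), R,
       \<lambda>i. if j \<le> i \<and> i < n \<and> M i < real (b + 2) then 0 else M i, P)"
proof (induction "n - j" arbitrary: j J M)
  case 0
  then have "j = n" by simp
  then have "(\<lambda>i. if j \<le> i \<and> i < n \<and> M i < real (b + 2) then 0 else M i) = M" "J(b := n + n) = J"
    using 0 by auto
  then show ?case using \<open>j = n\<close> reach.refl by simp
next
  case (Suc d)
  then have j: "j < n" and d: "d = n - Suc j" "Suc j \<le> n" "n - j = Suc (n - Suc j)" by auto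
  let ?J = "J(b := J b + 1)" and ?M = "if M j < real (b + 2) then M(j := 0) else M"
  have nx: "next_config (b, V, J, R, M, P) = (b, V, ?J, R, ?M, P)"
    using j Suc.prems by (simp add: next_config_def)
  have act: "active (b, V, J, R, M, P)" using assms by (simp add: active_def)
  have M: "(\<lambda>i. if Suc j \<le> i \<and> i < n \<and> ?M i < real (b + 2) then 0 else ?M i)
     = (\<lambda>i. if j \<le> i \<and> i < n \<and> M i < real (b + 2) then 0 else M i)"
    using j by (auto simp: fun_eq_iff Suc_le_eq order_le_less)
  have J: "?J(b := n + n) = J(b := n + n)" by simp
  have "?J b = n + Suc j" using Suc.prems by simp
  note IH = Suc.hyps(1)[where j = "Suc j" and J = ?J and M = ?M, OF d(1,2) this, unfolded M J]
  show ?case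
    unfolding d(3) by (rule reach.Suc[OF act, unfolded nx, OF IH])
qed

primrec call_time :: "nat \<Rightarrow> nat" where
  "call_time 0 = Suc (2 * n)"
| "call_time (Suc b) = Suc (2 * n) + \<Delta> * call_time b"

text \<open>Base \<Delta> + 1 instead of \<Delta> absorbs the 2 n + 1 steps of scan, sweep and
  return added on each level.\<close>

lemma call_time_le: "call_time b \<le> Suc (2 * n) * Suc \<Delta> ^ b"
proof (induction b)
  case (Suc b)
  have "call_time (Suc b) \<le> Suc (2 * n) + \<Delta> * (Suc (2 * n) * Suc \<Delta> ^ b)"
    using Suc by simp
  also have "\<dots> \<le> Suc (2 * n) * Suc \<Delta> ^ b + \<Delta> * (Suc (2 * n) * Suc \<Delta> ^ b)"
    using mult_le_mono2[of 1 "Suc \<Delta> ^ b" "Suc (2 * n)"] by simp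
  finally show ?case by (simp add: algebra_simps)
qed simp

lemma call_spec_step:
  assumes call: "0 < b \<Longrightarrow> call_spec (b - 1) \<tau>" and b: "b < top"
  shows "call_spec b (Suc (2 * n) + \<Delta> * \<tau>)"
  unfolding call_spec_def
proof (intro allI impI)
  fix v :: nat and V J R :: "nat \<Rightarrow> nat" and M :: "nat \<Rightarrow> real" and P :: "nat \<Rightarrow> complex"
  assume v: "v < n" and deleted: "M v \<noteq> 0" and init: "V b = 1 + v * n" "J b = 0" "R b = 1" "P b = (1 :: complex)"
    and marks: "\<forall>i. M i = 0 \<or> real (b + 2) \<le> M i"
  let ?M = "\<lambda>i. if i \<in> N v \<and> 0 \<le> i \<and> i < n \<and> M i = 0 \<and> 0 < b then real (b + 1) else M i"
  have B: "\<forall>i<n. i \<in> N v \<longleftrightarrow> A (V b + i) \<or> \<not> b < top" using init nbr[OF v] b by auto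
  have m: "\<forall>i. M i = 0 \<or> real (b + 1) \<le> M i"
  proof
    show "M i = 0 \<or> real (b + 1) \<le> M i" for i using marks[rule_format, of i] by auto
  qed
  have R0: "R b = 1 + 0 * n" using init by simp
  obtain k V' J' R' P' where k: "reach k (b, V, J, R, M, P) (b, V', J', R', ?M, P')"
      "J' b = n" "\<forall>i>b. V' i = V i \<and> J' i = J i \<and> R' i = R i \<and> P' i = P i"
      "P' b = P b * trunc_prod [0..<n] b (N v) (unmarked M) [0..<n]"
      "k \<le> (n - 0) + \<tau> * card (N v \<inter> {0..<n})"
    using scan[where j = 0 and V = V and J = J and R = R and M = M and P = P, OF call less_imp_le[OF b] init(2) le0 R0 B m]
    by blast
  have un: "reach (n - 0) (b, V', J', R', ?M, P') (b, V', J'(b := n + n), R',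
       \<lambda>i. if 0 \<le> i \<and> i < n \<and> ?M i < real (b + 2) then 0 else ?M i, P')"
    by (rule unmark[OF b]) (use k in auto)
  \<comment> \<open>The scan wrote b + 1 only where the mark was 0, and the older marks are at least
    b + 2, so the sweep undoes exactly the scan.\<close>
  have M: "(\<lambda>i. if 0 \<le> i \<and> i < n \<and> ?M i < real (b + 2) then 0 else ?M i) = M"
  proof
    fix i show "(if 0 \<le> i \<and> i < n \<and> ?M i < real (b + 2) then 0 else ?M i) = M i"
      using marks[rule_format, of i] by auto
  qed
  let ?P = "P'(b + 1 := P' (b + 1) * (1 + lam / P' b))"
  have ret: "reach (Suc 0) (b, V', J'(b := n + n), R', M, P') (Suc b, V', J'(b := n + n), R', M, ?P)"
    by (rule reach.Suc) (use b reach.refl in \<open>auto simp: active_def next_config_def\<close>)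
  have r: "reach (k + ((n - 0) + Suc 0)) (b, V, J, R, M, P) (Suc b, V', J'(b := n + n), R', M, ?P)"
    by (rule reach_trans[OF k(1) reach_trans[OF un[unfolded M] ret]])
  have "finite (N v)" using nbr[OF v] by simp
  then have "card (N v \<inter> {0..<n}) \<le> \<Delta>"
    using card_nbr[of v] card_mono[of "N v" "N v \<inter> {0..<n}"] by simp
  then have "\<tau> * card (N v \<inter> {0..<n}) \<le> \<Delta> * \<tau>" by (simp add: mult.commute)
  then have t: "k + ((n - 0) + Suc 0) \<le> Suc (2 * n) + \<Delta> * \<tau>" using k(5) by linarith
  have "insert v (unmarked M) - {v} = unmarked M"
    using deleted by (auto simp: unmarked_def)
  then have P: "?P (Suc b) = P (Suc b) * trunc_ratio [0..<n] b (insert v (unmarked M)) v"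
    using k(3,4) init by (simp add: trunc_ratio_def)
  have above: "\<forall>i>b. V' i = V i \<and> (J'(b := n + n)) i = J i \<and> R' i = R i" "\<forall>i>Suc b. ?P i = P i"
    using k(3) by auto
  from r above P t show "\<exists>k V' J' R' P'. reach k (b, V, J, R, M, P) (Suc b, V', J', R', M, P') \<and>
        (\<forall>i>b. V' i = V i \<and> J' i = J i \<and> R' i = R i) \<and> (\<forall>i>Suc b. P' i = P i) \<and>
        P' (Suc b) = P (Suc b) * trunc_ratio [0..<n] b (insert v (unmarked M)) v \<and>
        k \<le> Suc (2 * n) + \<Delta> * \<tau>"
    by blast
qed

lemma call_spec_call_time: "b < top \<Longrightarrow> call_spec b (call_time b)"
proof (induction b)
  case 0
  then show ?case using call_spec_step[of 0 0] by simp
next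
  case (Suc b)
  then show ?case using call_spec_step[of "Suc b" "call_time b"] by simp
qed

lemma search_result:
  assumes "J top = 0" "R top = 1" "P top = 1" "M = (\<lambda>_. 0)"
  shows "\<exists>k y. reach k (top, V, J, R, M, P) y \<and> \<not> active y \<and> fst y = top \<and>
    snd (snd (snd (snd (snd y)))) top = trunc_prod [0..<n] top UNIV {0..<n} [0..<n] \<and>
    k \<le> n + n * (Suc (2 * n) * Suc \<Delta> ^ (top - 1))"
proof -
  have cs: "call_spec (top - 1) (call_time (top - 1))" if "0 < top"
    using that by (intro call_spec_call_time) simp
  have R: "R top = 1 + 0 * n" and B: "\<forall>i<n. i \<in> UNIV \<longleftrightarrow> A (V top + i) \<or> \<not> top < top"
    and marks: "\<forall>i. M i = 0 \<or> real (top + 1) \<le> M i"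
    using assms by auto
  have un: "unmarked M = {0..<n}" using assms by (auto simp: unmarked_def)
  obtain k V' J' R' P' M' where k: "reach k (top, V, J, R, M, P) (top, V', J', R', M', P')"
      "J' top = n" "P' top = P top * trunc_prod [0..<n] top UNIV (unmarked M) [0..<n]"
      "k \<le> (n - 0) + call_time (top - 1) * card (UNIV \<inter> {0..<n})"
    using scan[where j = 0 and V = V and J = J and R = R and M = M and P = P,
        OF cs order_refl assms(1) le0 R B marks] by blast
  have "k \<le> n + n * call_time (top - 1)" using k(4) by (simp add: mult.commute)
  also have "\<dots> \<le> n + n * (Suc (2 * n) * Suc \<Delta> ^ (top - 1))"
    by (intro add_left_mono mult_le_mono2 call_time_le)
  finally show ?thesis
    using k(1-3) assms(3) unfolding un
    by (intro exI[of _ k] exI[of _ "(top, V', J', R', M', P')"]) (simp add: active_def)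
qed

end

section \<open>The program\<close>

text \<open>Unbounded arrays share a memory by residue modulo 3: offsets 3, 4, 5 in complex memory
  and 5, 6, 7 in natural memory, all beyond the registers in use.\<close>

definition cell :: "nat \<Rightarrow> nat \<Rightarrow> nat" where
  "cell k i = 3 * i + k"

lemma cell_eq [simp]: "cell k i = cell k j \<longleftrightarrow> i = j"
  by (simp add: cell_def)

lemma cell_disjoint [simp]:
  "cell 3 i \<noteq> cell 4 j" "cell 3 i \<noteq> cell 5 j" "cell 4 i \<noteq> cell 3 j"
  "cell 4 i \<noteq> cell 5 j" "cell 5 i \<noteq> cell 3 j" "cell 5 i \<noteq> cell 4 j"
  "cell 5 i \<noteq> cell 6 j" "cell 5 i \<noteq> cell 7 j" "cell 6 i \<noteq> cell 5 j"
  "cell 6 i \<noteq> cell 7 j" "cell 7 i \<noteq> cell 5 j" "cell 7 i \<noteq> cell 6 j"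
  unfolding cell_def by presburger+

lemma cell_not_register [simp]:
  assumes "r < 5"
  shows "cell 5 i \<noteq> r" "cell 6 i \<noteq> r" "cell 7 i \<noteq> r" "r \<noteq> cell 5 i" "r \<noteq> cell 6 i" "r \<noteq> cell 7 i"
  using assms by (auto simp: cell_def)

lemma cell_not_scalar [simp]:
  assumes "r < 3"
  shows "cell 3 i \<noteq> r" "cell 4 i \<noteq> r" "cell 5 i \<noteq> r" "r \<noteq> cell 3 i" "r \<noteq> cell 4 i" "r \<noteq> cell 5 i"
  using assms by (auto simp: cell_def)

definition cell_exp :: "nat \<Rightarrow> nexp \<Rightarrow> nexp" where
  "cell_exp k e = NAdd (NAdd e (NAdd e e)) (NLit k)"

lemma nval_cell_exp [simp]: "nval (cell_exp k e) s = cell k (nval e s)"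
  by (simp add: cell_exp_def cell_def)

text \<open>Natural registers: \<open>0\<close> holds \<open>n\<close>, \<open>1\<close> the current frame, \<open>2\<close> the number \<open>n\<^sup>2\<close>, \<open>3\<close> a counter
  and \<open>4\<close> the top frame; the stack arrays \<open>V\<close>, \<open>J\<close>, \<open>R\<close> occupy \<open>cell 5\<close>, \<open>cell 6\<close>, \<open>cell 7\<close>.
  Complex memory holds \<open>\<lambda>\<close> in \<open>0\<close>, a multiple of \<open>\<epsilon>\<close> in \<open>1\<close>, a copy of the adjacency matrix in
  \<open>cell 3\<close> (made because the registers overwrite the beginning of the original), the marks in \<open>cell 4\<close>
  and the products in \<open>cell 5\<close>.\<close>

definition reg :: "nat \<Rightarrow> nexp" where "reg r = NMem (NLit r)"
definition rowV :: nexp where "rowV = NMem (cell_exp 5 (reg 1))"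
definition posJ :: nexp where "posJ = NMem (cell_exp 6 (reg 1))"
definition rowR :: nexp where "rowR = NMem (cell_exp 7 (reg 1))"

definition below :: nexp where "below = NSub (reg 1) (NLit 1)"
definition above :: nexp where "above = NAdd (reg 1) (NLit 1)"

definition guard :: bexp where
  "guard = BNot (BAnd (BNot (NLess (reg 1) (reg 4))) (BNot (NLess posJ (reg 0))))"

definition callable :: bexp where
  "callable = BAnd
     (BNot (BAnd (BNot (ReLess (CLit 0) (CMem (cell_exp 3 (NAdd rowV posJ))))) (NLess (reg 1) (reg 4))))
     (BAnd (BNot (ReLess (CLit 0) (CMem (cell_exp 4 posJ)))) (NLess (NLit 0) (reg 1)))"

definition advance :: com where
  "advance = NAssign (cell_exp 6 (reg 1)) (NAdd posJ (NLit 1))"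

text \<open>The order realises a simultaneous update: the mark is set before the scan position
  moves, the row pointer is handed down before it advances, and the frame register changes
  last.\<close>

definition descend :: com where
  "descend =
     Seq (CAssign (cell_exp 4 posJ) (COfNat above))
    (Seq (NAssign (cell_exp 5 below) rowR)
    (Seq (NAssign (cell_exp 7 (reg 1)) (NAdd rowR (reg 0)))
    (Seq advance
    (Seq (NAssign (cell_exp 6 below) (NLit 0))
    (Seq (NAssign (cell_exp 7 below) (NLit 1))
    (Seq (CAssign (cell_exp 5 below) (CLit 1))
         (NAssign (NLit 1) below)))))))"

definition clear_mark :: com where
  "clear_mark =
     Ite (ReLess (CMem (cell_exp 4 (NSub posJ (reg 0)))) (COfNat (NAdd (reg 1) (NLit 2))))
       (CAssign (cell_exp 4 (NSub posJ (reg 0))) (CLit 0)) Skip"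

definition ascend :: com where
  "ascend =
     Seq (CAssign (cell_exp 5 above) (CMul (CMem (cell_exp 5 above))
            (CAdd (CLit 1) (CDiv (CMem (NLit 0)) (CMem (cell_exp 5 (reg 1)))))))
         (NAssign (NLit 1) above)"

definition body :: com where
  "body =
     Ite (NLess posJ (reg 0))
       (Ite callable descend (Seq (NAssign (cell_exp 7 (reg 1)) (NAdd rowR (reg 0))) advance))
       (Ite (NLess posJ (NAdd (reg 0) (reg 0))) (Seq clear_mark advance) ascend)"

lemmas exp_defs = reg_def rowV_def posJ_def rowR_def below_def above_def

lemma straight_body: "straight body"
  by (simp add: body_def descend_def advance_def clear_mark_def ascend_def)

definition config_of :: "state \<Rightarrow> config" where
  "config_of s = (fst s 1, \<lambda>b. fst s (cell 5 b), \<lambda>b. fst s (cell 6 b), \<lambda>b. fst s (cell 7 b),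
     \<lambda>j. Re (snd s (cell 4 j)), \<lambda>b. snd s (cell 5 b))"

context search begin

definition env :: "state \<Rightarrow> bool" where
  "env s \<longleftrightarrow> fst s 0 = n \<and> fst s 4 = top \<and> snd s 0 = lam \<and> (\<forall>a. A a \<longleftrightarrow> 0 < Re (snd s (cell 3 a)))"

lemma bval_guard: "env s \<Longrightarrow> bval guard s \<longleftrightarrow> active (config_of s)"
  by (auto simp: guard_def active_def config_of_def env_def exp_defs)

lemma step_body:
  assumes "env s"
  shows "env (step body s) \<and> config_of (step body s) = next_config (config_of s)"
proof -
  let ?J = "fst s (cell 6 (fst s 1))"
  consider "?J < n" "bval callable s" | "?J < n" "\<not> bval callable s"
    | "\<not> ?J < n" "?J < n + n" | "\<not> ?J < n" "\<not> ?J < n + n" by blast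
  then show ?thesis
  proof cases
    case 1
    then have st: "step body s = step descend s"
      using assms by (simp add: body_def env_def exp_defs)
    have call: "(A (fst s (cell 5 (fst s 1)) + ?J) \<or> \<not> fst s 1 < top) \<and>
        \<not> 0 < Re (snd s (cell 4 ?J)) \<and> 0 < fst s 1"
      using 1 assms by (auto simp: callable_def env_def exp_defs)
    then have nx: "next_config (config_of s) = (fst s 1 - 1, (\<lambda>b. fst s (cell 5 b))(fst s 1 - 1 := fst s (cell 7 (fst s 1))),
        (\<lambda>b. fst s (cell 6 b))(fst s 1 := ?J + 1, fst s 1 - 1 := 0),
        (\<lambda>b. fst s (cell 7 b))(fst s 1 := fst s (cell 7 (fst s 1)) + n, fst s 1 - 1 := 1),
        (\<lambda>j. Re (snd s (cell 4 j)))(?J := real (fst s 1 + 1)), (\<lambda>b. snd s (cell 5 b))(fst s 1 - 1 := 1))"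
      using 1 by (simp add: next_config_def config_of_def)
    show ?thesis unfolding st nx using assms
      by (auto simp: descend_def advance_def env_def config_of_def exp_defs fun_eq_iff)
  next
    case 2
    then have st: "step body s = step (Seq (NAssign (cell_exp 7 (reg 1)) (NAdd rowR (reg 0))) advance) s"
      using assms by (simp add: body_def env_def exp_defs)
    have "\<not> ((A (fst s (cell 5 (fst s 1)) + ?J) \<or> \<not> fst s 1 < top) \<and>
        \<not> 0 < Re (snd s (cell 4 ?J)) \<and> 0 < fst s 1)"
      using 2 assms by (auto simp: callable_def env_def exp_defs)
    then have nx: "next_config (config_of s) = (fst s 1, \<lambda>b. fst s (cell 5 b),
        (\<lambda>b. fst s (cell 6 b))(fst s 1 := ?J + 1),
        (\<lambda>b. fst s (cell 7 b))(fst s 1 := fst s (cell 7 (fst s 1)) + n),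
        \<lambda>j. Re (snd s (cell 4 j)), \<lambda>b. snd s (cell 5 b))"
      using 2 by (auto simp: next_config_def config_of_def)
    show ?thesis unfolding st nx using assms
      by (auto simp: advance_def env_def config_of_def exp_defs fun_eq_iff)
  next
    case 3
    then have st: "step body s = step (Seq clear_mark advance) s"
      using assms by (simp add: body_def env_def exp_defs)
    have nx: "next_config (config_of s) = (fst s 1, \<lambda>b. fst s (cell 5 b),
        (\<lambda>b. fst s (cell 6 b))(fst s 1 := ?J + 1), \<lambda>b. fst s (cell 7 b),
        if Re (snd s (cell 4 (?J - n))) < real (fst s 1 + 2)
        then (\<lambda>j. Re (snd s (cell 4 j)))(?J - n := 0) else (\<lambda>j. Re (snd s (cell 4 j))),
        \<lambda>b. snd s (cell 5 b))"
      using 3 by (simp add: next_config_def config_of_def)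
    show ?thesis unfolding st nx using assms
      by (auto simp: clear_mark_def advance_def env_def config_of_def exp_defs fun_eq_iff)
  next
    case 4
    then have st: "step body s = step ascend s"
      using assms by (simp add: body_def env_def exp_defs)
    have nx: "next_config (config_of s) = (fst s 1 + 1, \<lambda>b. fst s (cell 5 b), \<lambda>b. fst s (cell 6 b),
        \<lambda>b. fst s (cell 7 b), \<lambda>j. Re (snd s (cell 4 j)),
        (\<lambda>b. snd s (cell 5 b))(fst s 1 + 1 := snd s (cell 5 (fst s 1 + 1)) * (1 + lam / snd s (cell 5 (fst s 1)))))"
      using 4 by (simp add: next_config_def config_of_def)
    show ?thesis unfolding st nx using assms
      by (auto simp: ascend_def env_def config_of_def exp_defs fun_eq_iff)
  qed
qed

text \<open>The step count of \<open>reach\<close> is the number of passes still to come, so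
  \<open>reach\<close> itself is the indexed loop invariant.\<close>

lemma terminates_search:
  "reach k x y \<Longrightarrow> \<not> active y \<Longrightarrow> env s \<Longrightarrow> config_of s = x \<Longrightarrow>
    terminates (While guard body) s (Suc k * iteration_time guard body)
      (\<lambda>s'. env s' \<and> config_of s' = y)"
proof -
  assume a: "reach k x y" "\<not> active y" "env s" "config_of s = x"
  have "terminates (While guard body) s (Suc k * iteration_time guard body)
      ((\<lambda>k s. env s \<and> reach k (config_of s) y) 0)"
  proof (rule terminates_While[OF straight_body])
    fix k s assume s: "env s \<and> reach (Suc k) (config_of s) y"
    then have "active (config_of s)" "reach k (next_config (config_of s)) y"
      by (auto elim: reach.cases)
    then show "bval guard s \<and> env (step body s) \<and> reach k (config_of (step body s)) y"
      using s bval_guard step_body by auto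
  next
    fix s assume s: "env s \<and> reach 0 (config_of s) y"
    then have "config_of s = y" by (auto elim: reach.cases)
    then show "\<not> bval guard s" using s a bval_guard by auto
  qed (use a in auto)
  then show ?thesis unfolding terminates_def by (auto elim: reach.cases)
qed

end

section \<open>Preparing the matrix copy and the depth; the complete program\<close>

definition copy_cell :: "nexp \<Rightarrow> com" where
  "copy_cell a = CAssign (cell_exp 3 a) (COfNat (NMem a))"

definition count :: com where
  "count = NAssign (NLit 3) (NAdd (reg 3) (NLit 1))"

text \<open>Addresses 1 to 4 are saved without a loop, since a loop counter would already overwrite
  one of them.\<close>

definition save_low :: com where
  "save_low =
     Seq (copy_cell (NLit 1)) (Seq (copy_cell (NLit 2)) (Seq (copy_cell (NLit 3)) (Seq (copy_cell (NLit 4))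
    (Seq (NAssign (NLit 2) (NLit 0)) (NAssign (NLit 3) (NLit 0))))))"

definition square_body :: com where
  "square_body = Seq (NAssign (NLit 2) (NAdd (reg 2) (reg 0))) count"

definition copy_body :: com where
  "copy_body = Seq (copy_cell (reg 3)) count"

definition init_depth :: "nat \<Rightarrow> com" where
  "init_depth l = Seq (Ite (ReLess (CLit 1) (CMem (NLit 1))) (CAssign (NLit 1) (CLit 1)) Skip)
     (NAssign (NLit 4) (NLit l))"

text \<open>Doubling min 1 \<epsilon> until it reaches c n computes the logarithm of c n /
  \<epsilon>; every doubling pays for \<open>m\<close> further levels, that is, for halving the
  error once more.\<close>

definition depth_guard :: "nat \<Rightarrow> bexp" where
  "depth_guard c = ReLess (CMem (NLit 1)) (CMul (CLit (int c)) (COfNat (reg 0)))"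

definition depth_body :: "nat \<Rightarrow> com" where
  "depth_body m = Seq (CAssign (NLit 1) (CAdd (CMem (NLit 1)) (CMem (NLit 1))))
     (NAssign (NLit 4) (NAdd (reg 4) (NLit m)))"

definition init_top :: com where
  "init_top = Seq (NAssign (NLit 1) (reg 4)) (Seq (NAssign (cell_exp 6 (reg 1)) (NLit 0))
     (Seq (NAssign (cell_exp 7 (reg 1)) (NLit 1)) (CAssign (cell_exp 5 (reg 1)) (CLit 1))))"

definition program :: "nat \<Rightarrow> nat \<Rightarrow> nat \<Rightarrow> com" where
  "program l m c =
     Seq save_low
    (Seq (While (NLess (reg 3) (reg 0)) square_body)
    (Seq (NAssign (NLit 3) (NLit 5))
    (Seq (While (NLess (reg 3) (NAdd (reg 2) (NLit 1))) copy_body)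
    (Seq (init_depth l)
    (Seq (While (depth_guard c) (depth_body m))
    (Seq init_top
    (Seq (While guard body)
         (CAssign (NLit 0) (CMem (cell_exp 5 (reg 4)))))))))))"

text \<open>Scaling the total cost of the program text by a bound \<open>X\<close> on the number of iterations of every
  loop accounts for all steps at once.\<close>

definition runs :: "nat \<Rightarrow> com \<Rightarrow> state \<Rightarrow> (state \<Rightarrow> bool) \<Rightarrow> bool" where
  "runs X p s Q \<longleftrightarrow> terminates p s (time_bound p * X) Q"

lemma terminates_mono: "terminates p s T Q \<Longrightarrow> T \<le> U \<Longrightarrow> terminates p s U Q"
  unfolding terminates_def by (meson order_trans)

lemma runs_straight: "straight p \<Longrightarrow> 0 < X \<Longrightarrow> Q (step p s) \<Longrightarrow> runs X p s Q"
  unfolding runs_def by (rule terminates_mono[OF terminates_straight]) auto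

lemma runs_Seq:
  assumes "runs X p s Q" "\<And>s'. Q s' \<Longrightarrow> runs X q s' Q'"
  shows "runs X (Seq p q) s Q'"
  using terminates_Seq[of p s _ Q q _ Q'] assms unfolding runs_def
  by (simp add: add_mult_distrib)

lemma runs_While:
  assumes "terminates (While b p) s (Suc k * iteration_time b p) Q" "Suc k \<le> X"
  shows "runs X (While b p) s Q"
  unfolding runs_def
proof (rule terminates_mono[OF assms(1)])
  show "Suc k * iteration_time b p \<le> time_bound (While b p) * X"
    using mult_le_mono1[OF assms(2), of "iteration_time b p"]
    by (simp only: iteration_time_def time_bound.simps mult.commute)
qed

text \<open>The number \<kappa> of doublings is pinned down by the guard holding before it and
  failing at it. The four bounds on \<open>X\<close> belong to the loops that copy, square, choose
  the depth and search.\<close>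

lemma runs_program:
  fixes lam :: complex and \<epsilon> :: real and \<Delta> m l c \<kappa> :: nat
  defines "e \<equiv> min 1 \<epsilon>" and "T \<equiv> l + m * \<kappa>"
  assumes "indep_graph N"
    and nbr: "\<And>v. v < n \<Longrightarrow> N v = {j. j < n \<and> 0 < N0 (1 + v * n + j)}"
    and card_nbr: "\<And>v. card (N v) \<le> \<Delta>"
    and N0: "N0 0 = n" "\<And>a. n * n < a \<Longrightarrow> N0 a = 0"
    and C0: "C0 = (\<lambda>a. if a = 0 then lam else if a = 1 then of_real \<epsilon> else 0)"
    and \<kappa>: "\<And>i. i < \<kappa> \<Longrightarrow> e * 2 ^ i < real c * real n" "real c * real n \<le> e * 2 ^ \<kappa>"
    and X: "Suc (n * n) \<le> X" "Suc n \<le> X" "Suc \<kappa> \<le> X"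
      "Suc (n + n * (Suc (2 * n) * Suc \<Delta> ^ (T - 1))) \<le> X"
  shows "runs X (program l m c) (N0, C0)
     (\<lambda>s. result s = indep_graph.trunc_prod N lam [0..<n] T UNIV {0..<n} [0..<n])"
proof -
  let ?A = "\<lambda>a. 1 \<le> a \<and> 0 < N0 a"
  interpret indep_graph N lam by fact
  interpret search N lam n T ?A \<Delta>
    by unfold_locales (auto simp: nbr card_nbr)
  have X0: "0 < X" using X(2) by simp
  \<comment> \<open>Addresses below \<open>a\<close> have been copied, and the original is intact
    from 5 on. Complex memory starts out zero there, so all marks are clear.\<close>
  define copied where "copied = (\<lambda>a (s :: state). snd s 0 = lam \<and> snd s 1 = of_real \<epsilon> \<and> fst s 0 = n \<and>
    (\<forall>i. snd s (cell 3 i) = (if 1 \<le> i \<and> i < a then of_nat (N0 i) else 0)) \<and>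
    (\<forall>i. snd s (cell 4 i) = 0) \<and> (\<forall>i\<ge>5. fst s i = N0 i))"
  define ready where "ready = (\<lambda>s :: state. snd s 0 = lam \<and> fst s 0 = n \<and>
    (\<forall>a. (?A a) = (0 < Re (snd s (cell 3 a)))) \<and> (\<forall>i. snd s (cell 4 i) = 0))"
  have four: "1 \<le> i \<and> i < 5 \<longleftrightarrow> i = 1 \<or> i = 2 \<or> i = 3 \<or> i = 4" for i :: nat by auto
  let ?T = "\<lambda>s. result s = trunc_prod [0..<n] T UNIV {0..<n} [0..<n]"
  let ?Q1 = "\<lambda>s. copied 5 s \<and> fst s 2 = 0 \<and> fst s 3 = 0"
  have p1: "runs X save_low (N0, C0) ?Q1"
    by (rule runs_straight[OF _ X0])
      (auto simp: save_low_def copy_cell_def copied_def four C0 N0)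
  let ?I2 = "\<lambda>k s. copied 5 s \<and> fst s 3 + k = n \<and> fst s 2 = fst s 3 * n"
  have p2: "runs X (While (NLess (reg 3) (reg 0)) square_body) s (?I2 0)" if "?Q1 s" for s
    by (rule runs_While[OF terminates_While[where I = ?I2] X(2)])
      (use that in \<open>auto simp: copied_def square_body_def count_def reg_def\<close>)
  let ?Q3 = "\<lambda>s. copied 5 s \<and> fst s 3 = 5 \<and> fst s 2 = n * n"
  have p3: "runs X (NAssign (NLit 3) (NLit 5)) s ?Q3" if "?I2 0 s" for s
    by (rule runs_straight[OF _ X0]) (use that in \<open>auto simp: copied_def\<close>)
  \<comment> \<open>Truncated subtraction covers matrices with fewer than 5 entries: the loop makes
    no pass, and the cells saved beyond the matrix are 0.\<close>
  let ?I4 = "\<lambda>k s. copied (fst s 3) s \<and> 5 \<le> fst s 3 \<and> fst s 2 = n * n \<and> k = Suc (n * n) - fst s 3"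
  have p4: "runs X (While (NLess (reg 3) (NAdd (reg 2) (NLit 1))) copy_body) s (?I4 0)" if "?Q3 s" for s
  proof -
    have "terminates (While (NLess (reg 3) (NAdd (reg 2) (NLit 1))) copy_body) s
      (Suc (Suc (n * n) - 5) * iteration_time (NLess (reg 3) (NAdd (reg 2) (NLit 1))) copy_body) (?I4 0)"
    proof (rule terminates_While[where I = ?I4])
      fix k s assume s: "?I4 (Suc k) s"
      then show "bval (NLess (reg 3) (NAdd (reg 2) (NLit 1))) s \<and> ?I4 k (step copy_body s)"
        by (auto simp: copied_def copy_body_def copy_cell_def count_def reg_def less_Suc_eq)
    qed (use that in \<open>auto simp: copied_def copy_body_def copy_cell_def count_def reg_def\<close>)
    then show ?thesis by (rule runs_While) (use X(1) in simp)
  qed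
  have fin: "ready s" if "?I4 0 s" for s
  proof -
    have "n * n < fst s 3" using that by simp
    then have "N0 i = 0" if "\<not> i < fst s 3" for i using N0(2)[of i] that by linarith
    then show ?thesis using that by (auto simp: copied_def ready_def)
  qed
  let ?Q5 = "\<lambda>s. ready s \<and> snd s 1 = of_real e \<and> fst s 4 = l"
  have p5: "runs X (init_depth l) s ?Q5" if "?I4 0 s" for s
    by (rule runs_straight[OF _ X0])
      (use that fin[OF that] in \<open>auto simp: copied_def ready_def init_depth_def e_def min_def\<close>)
  let ?I6 = "\<lambda>k s. ready s \<and> (\<exists>i. i + k = \<kappa> \<and> snd s 1 = of_real (e * 2 ^ i) \<and> fst s 4 = l + m * i)"
  have p6: "runs X (While (depth_guard c) (depth_body m)) s (?I6 0)" if "?Q5 s" for s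
  proof -
    have "terminates (While (depth_guard c) (depth_body m)) s
       (Suc \<kappa> * iteration_time (depth_guard c) (depth_body m)) (?I6 0)"
    proof (rule terminates_While[where I = ?I6])
      fix k s assume "?I6 (Suc k) s"
      then obtain i where s: "ready s" "i + Suc k = \<kappa>" "snd s 1 = of_real (e * 2 ^ i)" "fst s 4 = l + m * i"
        by blast
      have "bval (depth_guard c) s"
        using \<kappa>(1)[of i] s by (simp add: depth_guard_def ready_def reg_def)
      moreover have "?I6 k (step (depth_body m) s)"
        using s by (intro conjI exI[of _ "Suc i"]) (auto simp: depth_body_def ready_def reg_def)
      ultimately show "bval (depth_guard c) s \<and> ?I6 k (step (depth_body m) s)" by blast
    next
      fix s assume "?I6 0 s"
      then show "\<not> bval (depth_guard c) s"
        using \<kappa>(2) by (auto simp: depth_guard_def ready_def reg_def)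
    qed (use that in \<open>auto simp: depth_body_def\<close>)
    then show ?thesis by (rule runs_While[OF _ X(3)])
  qed
  \<comment> \<open>The stack arrays overlap the original matrix and still contain its entries, so
    only the top frame is known; \<open>descend\<close> initialises each lower frame on
    entry.\<close>
  let ?Q7 = "\<lambda>s. env s \<and> (\<exists>V J R P. config_of s = (T, V, J, R, \<lambda>_. 0, P) \<and>
      J T = 0 \<and> R T = 1 \<and> P T = 1)"
  have p7: "runs X init_top s ?Q7" if "?I6 0 s" for s
  proof (rule runs_straight[OF _ X0])
    show "?Q7 (step init_top s)"
      unfolding env_def config_of_def using that
      by (auto simp: ready_def init_top_def reg_def T_def)
  qed (simp add: init_top_def)
  let ?Q8 = "\<lambda>s. env s \<and> snd s (cell 5 T) = trunc_prod [0..<n] T UNIV {0..<n} [0..<n]"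
  have p8: "runs X (While guard body) s ?Q8" if s: "?Q7 s" for s
  proof -
    obtain V J R P where c: "config_of s = (T, V, J, R, \<lambda>_. 0, P)" "J T = 0" "R T = 1" "P T = 1"
      using s by blast
    obtain k y where k: "reach k (config_of s) y" "\<not> active y"
      "snd (snd (snd (snd (snd y)))) T = trunc_prod [0..<n] T UNIV {0..<n} [0..<n]"
      "k \<le> n + n * (Suc (2 * n) * Suc \<Delta> ^ (T - 1))"
      using search_result[of J R P "\<lambda>_. 0" V] c by auto
    have "terminates (While guard body) s (Suc k * iteration_time guard body) (\<lambda>s'. env s' \<and> config_of s' = y)"
      using terminates_search[OF k(1,2)] s by blast
    then have "runs X (While guard body) s (\<lambda>s'. env s' \<and> config_of s' = y)"
      by (rule runs_While) (use X(4) k(4) in linarith)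
    moreover have "?Q8 s'" if "env s' \<and> config_of s' = y" for s'
      using that k(3) by (auto simp: config_of_def)
    ultimately show ?thesis unfolding runs_def terminates_def by blast
  qed
  have p9: "runs X (CAssign (NLit 0) (CMem (cell_exp 5 (reg 4)))) s ?T" if "?Q8 s" for s
  proof (rule runs_straight[OF _ X0])
    have "fst s 4 = T" using that unfolding env_def by blast
    then show "?T (step (CAssign (NLit 0) (CMem (cell_exp 5 (reg 4)))) s)"
      using that by (simp add: reg_def result_def)
  qed simp
  show ?thesis
    unfolding program_def
    by (rule runs_Seq, rule p1, rule runs_Seq, erule p2, rule runs_Seq, erule p3, rule runs_Seq, erule p4,
        rule runs_Seq, erule p5, rule runs_Seq, erule p6, rule runs_Seq, erule p7, rule runs_Seq, erule p8,
        erule p9)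
qed

section \<open>Relative error, vertex numbering and running time\<close>

lemma half_le_sin:
  fixes x :: real
  assumes "0 \<le> x" "x \<le> 1"
  shows "x / 2 \<le> sin x"
proof -
  have "\<bar>sin x - (\<Sum>m<3. sin_coeff m * x ^ m)\<bar> \<le> inverse (fact 3) * \<bar>x\<bar> ^ 3"
    by (rule Maclaurin_sin_bound)
  then have "x - sin x \<le> x ^ 3 / 6"
    using assms by (simp add: sin_coeff_def eval_nat_numeral fact_numeral abs_if split: if_splits)
  moreover have "x ^ 3 \<le> x" using power_decreasing[of 1 3 x] assms by simp
  ultimately show ?thesis using assms by linarith
qed

text \<open>With w = \<xi> / q the modulus bounds are immediate, and the angle is arccos (Re w /
  |w|). Its comparison with e = min 1 \<epsilon> rests on cos e \<le> 1 - e^2 / 8.\<close>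

lemma mult_approx_if_close:
  assumes "0 < \<epsilon>" "q \<noteq> 0" and close: "norm (\<xi> / q - 1) \<le> min 1 \<epsilon> / 4"
  shows "mult_approx \<epsilon> \<xi> q"
proof -
  define e where "e = min 1 \<epsilon>"
  define w where "w = \<xi> / q"
  have e: "0 < e" "e \<le> 1" "e \<le> \<epsilon>" using assms by (auto simp: e_def)
  have w: "norm (w - 1) \<le> e / 4" using close by (simp add: w_def e_def)
  have \<xi>: "\<xi> = w * q" using assms by (simp add: w_def)
  have lo: "1 - e / 4 \<le> norm w" and hi: "norm w \<le> 1 + e / 4"
    using w norm_triangle_ineq2[of w 1] norm_triangle_ineq2[of 1 w] by (auto simp: norm_minus_commute)
  have pos: "0 < norm w" using lo e by linarith
  have ratio: "norm q / norm \<xi> = 1 / norm w"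
    using assms by (simp add: \<xi> norm_mult)
  have exp: "1 + e \<le> exp \<epsilon>" using exp_ge_add_one_self[of \<epsilon>] e by linarith
  have "norm w \<le> exp \<epsilon>" using hi exp e by linarith
  then have 1: "exp (- \<epsilon>) \<le> norm q / norm \<xi>"
    using pos by (simp add: ratio exp_minus field_simps)
  have "e * e \<le> e" using e by (simp add: mult_left_le)
  then have "1 \<le> (1 - e / 4) * (1 + e)" using e by (simp add: algebra_simps)
  also have "\<dots> \<le> norm w * exp \<epsilon>"
    using lo exp e by (intro mult_mono) auto
  finally have 2: "norm q / norm \<xi> \<le> exp \<epsilon>"
    using pos by (simp add: ratio field_simps)
  have im: "\<bar>Im w\<bar> \<le> e / 4" and "\<bar>Re w - 1\<bar> \<le> e / 4"
    using w abs_Im_le_cmod[of "w - 1"] abs_Re_le_cmod[of "w - 1"] by auto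
  then have re: "3 / 4 \<le> Re w" using e by linarith
  have im2: "(Im w)\<^sup>2 \<le> e\<^sup>2 / 16" using power_mono[OF im, of 2] by (simp add: power_divide)
  have "(norm w)\<^sup>2 = (Re w)\<^sup>2 + (Im w)\<^sup>2" by (rule cmod_power2)
  \<comment> \<open>A linear bound on |w| - Re w would be too weak, since 1 - cos e is quadratic in
    e; this identity yields e^2 / 16.\<close>
  then have diff: "(norm w - Re w) * (norm w + Re w) = (Im w)\<^sup>2"
    by (simp add: power2_eq_square algebra_simps)
  have "(norm w - Re w) * 1 \<le> (norm w - Re w) * (norm w + Re w)"
    using re complex_Re_le_cmod[of w] by (intro mult_left_mono) auto
  then have close_re: "norm w - e\<^sup>2 / 16 \<le> Re w" using diff im2 by simp
  have "e / 4 \<le> sin (e / 2)" using half_le_sin[of "e / 2"] e by simp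
  then have "(e / 4)\<^sup>2 \<le> (sin (e / 2))\<^sup>2" using e by (intro power_mono) auto
  moreover have "cos e = 1 - 2 * (sin (e / 2))\<^sup>2" using cos_double_sin[of "e / 2"] by simp
  ultimately have cos: "cos e \<le> 1 - e\<^sup>2 / 8" by (simp add: power_divide)
  have "cos e * norm w \<le> (1 - e\<^sup>2 / 8) * norm w"
    using cos by (intro mult_right_mono) auto
  also have "\<dots> \<le> norm w - e\<^sup>2 / 16"
  proof -
    have "e\<^sup>2 / 8 * (1 / 2) \<le> e\<^sup>2 / 8 * norm w" using lo e by (intro mult_left_mono) auto
    then show ?thesis by (simp add: algebra_simps)
  qed
  finally have "cos e \<le> Re w / norm w" using close_re pos by (simp add: field_simps)
  moreover have "Re w / norm w \<le> 1" using complex_Re_le_cmod[of w] pos by simp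
  ultimately have "arccos (Re w / norm w) \<le> arccos (cos e)"
    by (intro arccos_le_arccos) auto
  also have "arccos (cos e) = e" using e pi_ge_two by (intro arccos_cos) auto
  finally have ang: "arccos (Re w / norm w) \<le> \<epsilon>" using e by linarith
  have "inner \<xi> q = Re w * (norm q)\<^sup>2"
    unfolding \<xi> inner_complex_def cmod_power2 by (simp add: power2_eq_square algebra_simps)
  then have "inner \<xi> q / (norm \<xi> * norm q) = Re w / norm w"
    using assms pos by (simp add: \<xi> norm_mult power2_eq_square)
  then have "vec_angle \<xi> q \<le> \<epsilon>" using ang by (simp add: vec_angle_def)
  moreover have "\<xi> \<noteq> 0" using assms pos by (auto simp: \<xi>)
  ultimately show ?thesis using assms 1 2 by (simp add: mult_approx_def)
qed

text \<open>Bounding \<open>v\<close> as well makes the relation symmetric on all naturals, as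
  \<open>indep_graph\<close> demands.\<close>

definition index_nbrs :: "nat list \<Rightarrow> nat set set \<Rightarrow> nat \<Rightarrow> nat set" where
  "index_nbrs vs E v = {j. j < length vs \<and> v < length vs \<and> {vs ! v, vs ! j} \<in> E}"

lemma indep_graph_index_nbrs:
  assumes "simple_graph (set vs) E"
  shows "indep_graph (index_nbrs vs E)"
proof
  show "v \<in> index_nbrs vs E u \<Longrightarrow> u \<in> index_nbrs vs E v" for u v
    by (auto simp: index_nbrs_def insert_commute)
  show "u \<notin> index_nbrs vs E u" for u
  proof
    assume "u \<in> index_nbrs vs E u"
    then have "card {vs ! u} = 2" using assms by (auto simp: index_nbrs_def simple_graph_def)
    then show False by simp
  qed
qed

lemma card_index_nbrs:
  assumes "simple_graph (set vs) E" "distinct vs" "\<forall>v\<in>set vs. graph_degree E v \<le> \<Delta>"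
  shows "card (index_nbrs vs E v) \<le> \<Delta>"
proof (cases "v < length vs")
  case True
  have "E \<subseteq> Pow (set vs)" using assms(1) by (auto simp: simple_graph_def)
  then have "finite E" by (rule finite_subset) simp
  have "inj_on (\<lambda>j. {vs ! v, vs ! j}) (index_nbrs vs E v)"
    using assms(2) by (auto simp: inj_on_def index_nbrs_def doubleton_eq_iff nth_eq_iff_index_eq)
  then have "card (index_nbrs vs E v) \<le> card {e \<in> E. vs ! v \<in> e}"
    by (rule card_inj_on_le) (use \<open>finite E\<close> in \<open>auto simp: index_nbrs_def\<close>)
  also have "\<dots> \<le> \<Delta>" using assms(3) True by (auto simp: graph_degree_def)
  finally show ?thesis .
next
  case False
  then have "index_nbrs vs E v = {}" by (simp add: index_nbrs_def)
  then show ?thesis by simp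
qed

text \<open>Taking images under the numbering is a bijection that preserves cardinality. Excluding
  edges and excluding neighbours agree because every edge has two endpoints.\<close>

lemma indep_poly_index_nbrs:
  assumes "simple_graph (set vs) E" "distinct vs"
  shows "indep_poly (set vs) E lam = indep_graph.Z (index_nbrs vs E) lam {0..<length vs}"
proof -
  interpret indep_graph "index_nbrs vs E" lam using assms(1) by (rule indep_graph_index_nbrs)
  let ?f = "(!) vs" and ?n = "length vs"
  have inj: "inj_on ?f {0..<?n}" using assms(2) by (auto simp: inj_on_def nth_eq_iff_index_eq)
  have V: "?f ` {0..<?n} = set vs" by (auto simp: in_set_conv_nth)
  have ind: "indep_set E (?f ` I) \<longleftrightarrow> (\<forall>i\<in>I. index_nbrs vs E i \<inter> I = {})" if "I \<subseteq> {0..<?n}" for I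
  proof
    assume "indep_set E (?f ` I)"
    then show "\<forall>i\<in>I. index_nbrs vs E i \<inter> I = {}"
      by (force simp: indep_set_def index_nbrs_def)
  next
    assume I: "\<forall>i\<in>I. index_nbrs vs E i \<inter> I = {}"
    show "indep_set E (?f ` I)"
      unfolding indep_set_def
    proof (intro ballI notI)
      fix e assume e: "e \<in> E" "e \<subseteq> ?f ` I"
      then have "card e = 2" using assms(1) by (auto simp: simple_graph_def)
      then obtain x y where xy: "e = {x, y}" by (auto simp: card_2_iff)
      with e obtain i j where ij: "i \<in> I" "x = vs ! i" "j \<in> I" "y = vs ! j" by auto
      then have "j \<in> index_nbrs vs E i \<inter> I" using e xy that by (auto simp: index_nbrs_def)
      then show False using I ij by blast
    qed
  qed
  have bij: "bij_betw ((`) ?f) (indeps {0..<?n}) {I. I \<subseteq> set vs \<and> indep_set E I}"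
    unfolding bij_betw_def
  proof
    show "inj_on ((`) ?f) (indeps {0..<?n})"
      using inj by (auto simp: inj_on_def indeps_def inj_on_image_eq_iff[OF inj])
    show "(`) ?f ` indeps {0..<?n} = {I. I \<subseteq> set vs \<and> indep_set E I}"
    proof (intro equalityI subsetI)
      fix I assume "I \<in> (`) ?f ` indeps {0..<?n}"
      then show "I \<in> {I. I \<subseteq> set vs \<and> indep_set E I}"
        using ind V by (auto simp: indeps_def)
    next
      fix I assume I: "I \<in> {I. I \<subseteq> set vs \<and> indep_set E I}"
      then obtain J where J: "J \<subseteq> {0..<?n}" "I = ?f ` J"
        unfolding V[symmetric] by (auto elim: subset_imageE)
      then show "I \<in> (`) ?f ` indeps {0..<?n}" using I ind[of J] by (auto simp: indeps_def)
    qed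
  qed
  have "indep_poly (set vs) E lam = (\<Sum>I\<in>indeps {0..<?n}. lam ^ card (?f ` I))"
    unfolding indep_poly_def by (rule sum.reindex_bij_betw[OF bij, symmetric])
  also have "\<dots> = Z {0..<?n}"
    unfolding Z_def
    by (rule sum.cong) (auto simp: indeps_def card_image[OF inj_on_subset[OF inj]])
  finally show ?thesis .
qed

text \<open>With h = (\<Delta> + 1)^m the tree size contains h^\<kappa> \<le> (2^h)^\<kappa> =
  (2^\<kappa>)^h, a power of fixed exponent of a quantity linear in n / \<epsilon>. The crude h
  \<le> 2^h avoids logarithms.\<close>

lemma polynomial_time:
  fixes w c m \<Delta> :: nat
  assumes c: "1 \<le> c"
  shows "\<exists>K. \<forall>n \<kappa> x. real n \<le> x \<longrightarrow> 2 ^ \<kappa> \<le> max 1 (2 * real c * x) \<longrightarrow>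
    real (w * (Suc (n * n) + Suc n + Suc \<kappa> + Suc (n + n * (Suc (2 * n) * Suc \<Delta> ^ Suc (m * \<kappa>))))) \<le> max 2 x ^ K"
proof -
  define h where "h = Suc \<Delta> ^ m"
  \<comment> \<open>The sum of all coefficients. As the base is at least 2, this constant is
    absorbed by \<open>a\<close> additional powers.\<close>
  define B where "B = real w * (7 + 2 * real c + 3 * real (Suc \<Delta>) * (2 * real c) ^ h)"
  obtain a where a: "B < 2 ^ a" using real_arch_pow[of 2 B] by auto
  show ?thesis
  proof (intro exI[of _ "a + (h + 2)"] allI impI)
    fix n \<kappa> :: nat and x :: real
    assume n: "real n \<le> x" and \<kappa>: "2 ^ \<kappa> \<le> max 1 (2 * real c * x)"
    define y where "y = max 2 x"
    define Y where "Y = y ^ (h + 2)"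
    have y: "2 \<le> y" "real n \<le> y" using n by (auto simp: y_def)
    have pow: "y ^ i \<le> Y" if "i \<le> h + 2" for i
      unfolding Y_def using y that by (intro power_increasing) auto
    have Y: "1 \<le> Y" "y \<le> Y" "y * y \<le> Y"
      using pow[of 0] pow[of 1] pow[of 2] by (auto simp: power2_eq_square)
    have cy: "1 * 1 \<le> 2 * real c * y" using c y by (intro mult_mono) auto
    have "2 * real c * x \<le> 2 * real c * y" by (intro mult_left_mono) (auto simp: y_def)
    then have k2: "2 ^ \<kappa> \<le> 2 * real c * y" using \<kappa> cy by linarith
    have "real \<kappa> \<le> 2 ^ \<kappa>" using less_exp[of \<kappa>] by (metis less_imp_le of_nat_le_iff of_nat_numeral of_nat_power)
    then have 1: "real \<kappa> \<le> 2 * real c * Y"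
      using k2 mult_left_mono[OF Y(2), of "2 * real c"] by linarith
    have "real (Suc \<Delta> ^ m) \<le> 2 ^ h"
      using less_exp[of h] by (metis h_def less_imp_le of_nat_le_iff of_nat_numeral of_nat_power)
    then have "real (Suc \<Delta> ^ m) ^ \<kappa> \<le> (2 ^ h) ^ \<kappa>" by (intro power_mono) auto
    also have "\<dots> = (2 ^ \<kappa>) ^ h" by (simp only: power_mult[symmetric] mult.commute)
    also have "\<dots> \<le> (2 * real c * y) ^ h" using k2 by (intro power_mono) auto
    finally have d: "real (Suc \<Delta> ^ m) ^ \<kappa> \<le> (2 * real c) ^ h * y ^ h"
      by (simp only: power_mult_distrib)
    have n3: "real n * real (Suc (2 * n)) \<le> y * (3 * y)"
      using y by (intro mult_mono) auto
    have split: "real (Suc \<Delta> ^ Suc (m * \<kappa>)) = real (Suc \<Delta>) * real (Suc \<Delta> ^ m) ^ \<kappa>"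
      by (simp only: of_nat_power power_Suc power_mult of_nat_mult)
    have "real (n * (Suc (2 * n) * Suc \<Delta> ^ Suc (m * \<kappa>)))
        = real (Suc \<Delta>) * ((real n * real (Suc (2 * n))) * real (Suc \<Delta> ^ m) ^ \<kappa>)"
      unfolding of_nat_mult split by (simp only: mult_ac)
    also have "\<dots> \<le> real (Suc \<Delta>) * ((y * (3 * y)) * ((2 * real c) ^ h * y ^ h))"
      using n3 d y by (intro mult_left_mono mult_mono) auto
    also have "\<dots> = 3 * real (Suc \<Delta>) * (2 * real c) ^ h * Y"
      by (simp add: Y_def power_add power2_eq_square mult_ac)
    finally have 2: "real (n * (Suc (2 * n) * Suc \<Delta> ^ Suc (m * \<kappa>))) \<le> 3 * real (Suc \<Delta>) * (2 * real c) ^ h * Y" .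
    have 3: "real (n * n) \<le> Y"
      using mult_mono[OF y(2) y(2)] y Y(3) by simp
    have 4: "real n \<le> Y" using y Y by linarith
    let ?X = "Suc (n * n) + Suc n + Suc \<kappa> + Suc (n + n * (Suc (2 * n) * Suc \<Delta> ^ Suc (m * \<kappa>)))"
    have "real ?X = 4 + real (n * n) + 2 * real n + real \<kappa> + real (n * (Suc (2 * n) * Suc \<Delta> ^ Suc (m * \<kappa>)))"
      by (simp only: of_nat_add of_nat_Suc)
    also have "\<dots> \<le> 4 * Y + Y + 2 * Y + 2 * real c * Y + 3 * real (Suc \<Delta>) * (2 * real c) ^ h * Y"
      using 1 2 3 4 Y(1) by linarith
    finally have "real w * real ?X \<le> real w * (4 * Y + Y + 2 * Y + 2 * real c * Y + 3 * real (Suc \<Delta>) * (2 * real c) ^ h * Y)"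
      by (intro mult_left_mono) auto
    also have "\<dots> = B * Y" by (simp add: B_def algebra_simps)
    also have "\<dots> \<le> y ^ a * Y"
    proof (rule mult_right_mono)
      have "(2 :: real) ^ a \<le> y ^ a" using y by (intro power_mono) auto
      then show "B \<le> y ^ a" using a by linarith
    qed (use Y in auto)
    finally show "real (w * ?X) \<le> max 2 x ^ (a + (h + 2))"
      by (simp only: of_nat_mult Y_def y_def power_add)
  qed
qed

text \<open>The lower bound 2 on the base lets the exponent absorb constant factors. Capping
  \<epsilon> at 1 keeps the base at least |V|, since the whole matrix is read however large
  \<epsilon> is.\<close>

theorem theorem1p1:
  fixes \<Delta> :: nat and lam :: complex
  assumes "norm lam < lambda_star \<Delta>"
    and "\<Delta> = 1 \<Longrightarrow> lam \<noteq> - 1 / 2"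
  shows "\<exists>(p :: com) (K :: nat). \<forall>(V :: nat set) E vs (\<epsilon> :: real).
    simple_graph V E \<longrightarrow> (\<forall>v\<in>V. graph_degree E v \<le> \<Delta>) \<longrightarrow>
    distinct vs \<longrightarrow> set vs = V \<longrightarrow> 0 < \<epsilon> \<longrightarrow>
    (\<exists>t s. exec p (initial_state lam E vs \<epsilon>) t s \<and>
           mult_approx \<epsilon> (result s) (indep_poly V E lam) \<and>
           real t \<le> max 2 (real (card V) / min 1 \<epsilon>) ^ K)"
proof -
  obtain C :: real and m where C: "0 \<le> C" and conv: "\<And>(N :: nat \<Rightarrow> nat set) vs S u k. indep_graph N \<Longrightarrow>
    (\<forall>v. finite (N v) \<and> card (N v) \<le> \<Delta>) \<Longrightarrow> distinct vs \<Longrightarrow> S \<subseteq> set vs \<Longrightarrow> u \<in> S \<Longrightarrow>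
    indep_graph.ratio N lam S u \<noteq> 0 \<and>
    norm (indep_graph.trunc_ratio N lam vs (Suc (m * k)) S u / indep_graph.ratio N lam S u - 1) \<le> C / 2 ^ k"
    using trunc_ratio_converges[OF assms] by metis
  \<comment> \<open>An integer, hence usable as a literal; 8 C makes the sum of the n errors at most
    e / 8.\<close>
  define c where "c = Suc (nat \<lceil>8 * C\<rceil>)"
  have c: "1 \<le> c" "8 * C \<le> real c" unfolding c_def by linarith+
  \<comment> \<open>The initial depth 2 consists of one level for the product over all vertices and
    one for the step at each root.\<close>
  define p where "p = program 2 m c"
  obtain K where K: "\<And>n \<kappa> x. real n \<le> x \<Longrightarrow> 2 ^ \<kappa> \<le> max 1 (2 * real c * x) \<Longrightarrow>
    real (time_bound p * (Suc (n * n) + Suc n + Suc \<kappa> + Suc (n + n * (Suc (2 * n) * Suc \<Delta> ^ Suc (m * \<kappa>))))) \<le> max 2 x ^ K"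
    using polynomial_time[OF c(1), of "time_bound p" \<Delta> m] by metis
  show ?thesis
  proof (rule exI[of _ p], rule exI[of _ K], intro allI impI)
    fix V :: "nat set" and E vs and \<epsilon> :: real
    assume graph: "simple_graph V E" and deg: "\<forall>v\<in>V. graph_degree E v \<le> \<Delta>"
      and vs: "distinct vs" "set vs = V" and \<epsilon>: "0 < \<epsilon>"
    define n where "n = length vs"
    define e where "e = min 1 \<epsilon>"
    define N where "N = index_nbrs vs E"
    have e: "0 < e" "e \<le> 1" using \<epsilon> by (auto simp: e_def)
    have g: "indep_graph N" unfolding N_def using graph vs by (intro indep_graph_index_nbrs) simp
    interpret indep_graph N lam by fact
    have dN: "card (N v) \<le> \<Delta>" for v
      unfolding N_def using graph vs deg by (intro card_index_nbrs) auto
    have fN: "finite (N v)" for v by (simp add: N_def index_nbrs_def)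
    have "\<exists>k. real c * real n / e < 2 ^ k" using real_arch_pow[of 2 "real c * real n / e"] by simp
    then have ex: "\<exists>k. real c * real n \<le> e * 2 ^ k"
      using e by (auto simp: field_simps intro: less_imp_le)
    \<comment> \<open>Minimality bounds 2^\<kappa> by twice c n / e, unless \<kappa> = 0; this keeps
      the tree polynomial.\<close>
    define \<kappa> where "\<kappa> = (LEAST k. real c * real n \<le> e * 2 ^ k)"
    have \<kappa>1: "real c * real n \<le> e * 2 ^ \<kappa>" unfolding \<kappa>_def by (rule LeastI_ex[OF ex])
    have \<kappa>2: "e * 2 ^ i < real c * real n" if "i < \<kappa>" for i
      using not_less_Least[OF that[unfolded \<kappa>_def]] by simp
    have two: "2 ^ \<kappa> \<le> max 1 (2 * real c * (real n / e))"
    proof (cases \<kappa>)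
      case (Suc i)
      then have "e * 2 ^ i < real c * real n" using \<kappa>2[of i] by simp
      then have "2 ^ \<kappa> \<le> 2 * real c * (real n / e)" using e by (simp add: Suc field_simps)
      then show ?thesis by simp
    qed simp
    define X where "X = Suc (n * n) + Suc n + Suc \<kappa> + Suc (n + n * (Suc (2 * n) * Suc \<Delta> ^ Suc (m * \<kappa>)))"
    define N0 where "N0 = (\<lambda>a. if a = 0 then n else if a \<le> n * n
       then of_bool ({vs ! ((a - 1) div n), vs ! ((a - 1) mod n)} \<in> E) else (0 :: nat))"
    define C0 where "C0 = (\<lambda>a :: nat. if a = 0 then lam else if a = 1 then of_real \<epsilon> else 0)"
    have init: "initial_state lam E vs \<epsilon> = (N0, C0)"
      unfolding initial_state_def N0_def C0_def n_def Let_def by simp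
    have nbr: "N v = {j. j < n \<and> 0 < N0 (1 + v * n + j)}" if "v < n" for v
    proof -
      have "N0 (1 + v * n + j) = of_bool ({vs ! v, vs ! j} \<in> E)" if "j < n" for j
      proof -
        have "v * n + j < Suc v * n" using \<open>j < n\<close> by simp
        also have "\<dots> \<le> n * n" using \<open>v < n\<close> by (intro mult_le_mono1) simp
        finally have "1 + v * n + j \<le> n * n" by simp
        moreover have "(v * n + j) div n = v" "(v * n + j) mod n = j" using \<open>j < n\<close> by auto
        ultimately show ?thesis by (simp add: N0_def)
      qed
      then show ?thesis using \<open>v < n\<close> by (auto simp: N_def index_nbrs_def n_def)
    qed
    have "runs X p (N0, C0) (\<lambda>s. result s = trunc_prod [0..<n] (2 + m * \<kappa>) UNIV {0..<n} [0..<n])"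
      unfolding p_def
      by (rule runs_program[where \<epsilon> = \<epsilon> and \<Delta> = \<Delta>])
        (use g nbr dN \<kappa>1 \<kappa>2 in \<open>auto simp: X_def N0_def C0_def e_def\<close>)
    then obtain t s where t: "exec p (N0, C0) t s" "t \<le> time_bound p * X"
      "result s = trunc_prod [0..<n] (Suc (Suc (m * \<kappa>))) UNIV {0..<n} [0..<n]"
      unfolding runs_def terminates_def by auto
    define \<eta> where "\<eta> = C / 2 ^ \<kappa>"
    have \<eta>: "0 \<le> \<eta>" using C by (simp add: \<eta>_def)
    have "8 * C * real n \<le> real c * real n" using c(2) by (intro mult_right_mono) auto
    then have n\<eta>: "real n * \<eta> \<le> e / 8" using \<kappa>1 by (simp add: \<eta>_def field_simps)
    have err: "Z {0..<n} \<noteq> 0" "norm (result s / Z {0..<n} - 1) \<le> (1 + \<eta>) ^ n - 1"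
    proof -
      have *: "ratio S u \<noteq> 0 \<and> norm (trunc_ratio [0..<n] (Suc (m * \<kappa>)) S u / ratio S u - 1) \<le> \<eta>"
        if "S \<subseteq> set [0..<n]" "u \<in> S" for S u
        unfolding \<eta>_def using conv[OF g _ distinct_upt that] dN fN by blast
      show "Z {0..<n} \<noteq> 0" "norm (result s / Z {0..<n} - 1) \<le> (1 + \<eta>) ^ n - 1"
        using trunc_prod_rel_error[OF * \<eta>, of "[0..<n]" "{0..<n}"] unfolding t(3) by simp_all
    qed
    \<comment> \<open>Since n \<eta> \<le> e / 8, the total relative error is at most n \<eta> + (n
      \<eta>)^2 \<le> 2 n \<eta> \<le> e / 4.\<close>
    have "(1 + \<eta>) ^ n \<le> exp \<eta> ^ n" using \<eta> exp_ge_add_one_self[of \<eta>] by (intro power_mono) auto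
    also have "\<dots> = exp (real n * \<eta>)" by (simp add: exp_of_nat_mult)
    also have "\<dots> \<le> 1 + real n * \<eta> + (real n * \<eta>)\<^sup>2"
      using \<eta> n\<eta> e by (intro exp_bound) auto
    also have "(real n * \<eta>)\<^sup>2 \<le> real n * \<eta>"
      using \<eta> n\<eta> e by (simp add: power2_eq_square mult_left_le)
    finally have "norm (result s / Z {0..<n} - 1) \<le> min 1 \<epsilon> / 4"
      using err(2) n\<eta> unfolding e_def by linarith
    moreover have poly: "indep_poly V E lam = Z {0..<n}"
      unfolding N_def n_def using indep_poly_index_nbrs[of vs E lam] graph vs by simp
    ultimately have approx: "mult_approx \<epsilon> (result s) (indep_poly V E lam)"
      using mult_approx_if_close[OF \<epsilon> err(1)] by simp
    have "real n \<le> real n / e" using mult_right_mono[OF e(2), of "real n"] e(1) by (simp add: field_simps)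
    then have "real (time_bound p * X) \<le> max 2 (real n / e) ^ K"
      unfolding X_def using two by (rule K)
    moreover have "real t \<le> real (time_bound p * X)" using t(2) by (simp only: of_nat_le_iff)
    moreover have "card V = n" using vs distinct_card n_def by blast
    ultimately have "real t \<le> max 2 (real (card V) / min 1 \<epsilon>) ^ K" by (simp add: e_def)
    then show "\<exists>t s. exec p (initial_state lam E vs \<epsilon>) t s \<and>
           mult_approx \<epsilon> (result s) (indep_poly V E lam) \<and>
           real t \<le> max 2 (real (card V) / min 1 \<epsilon>) ^ K"
      using t(1) approx unfolding init by blast
  qed
qed

end
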